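(* Let $E\subset\mathbb{R}$ be a measurable set with $0<\operatorname{mes}E\le\infty$. If the truncated Fourier operator $\mathscr{F}_E$ is a Hilbert–Schmidt operator, $\mathscr{F}_E\in\mathfrak{S}_2$, then the set $E$ is of finite measure, and the equality $$\Vert\mathscr{F}_E\Vert_{\mathfrak{S}_2}=\operatorname{mes}E$$ holds.
   Context: $\operatorname{mes}$ denotes Lebesgue measure on $\mathbb{R}$; $L^2(E)$ is the complex Hilbert space of square-integrable functions on $E$. The truncated Fourier operator $\mathscr{F}_E:L^2(E)\to L^2(E)$ is defined by $(\mathscr{F}_Ex)(t)=\frac{1}{\sqrt{2\pi}}\int_E e^{it\xi}x(\xi)\,d\xi$, $t\in E$; when $\operatorname{mes}E=\infty$ the integral is understood in the Fourier–Plancherel sense, i.e. $\mathscr{F}_Ex$ is the restriction to $E$ of the $L^2(\mathbb{R})$ Fourier–Plancherel transform (the unitary extension by continuity of $x\mapsto\frac{1}{\sqrt{2\pi}}\int_{\mathbb{R}}e^{it\xi}x(\xi)\,d\xi$) of $x$ extended by zero outside $E$. $\mathfrak{S}_2$ is the class of Hilbert–Schmidt operators and $\Vert\cdot\Vert_{\mathfrak{S}_2}$ is the Hilbert–Schmidt norm.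
   Formalization: The equality is proved as ‖F_E‖_{S_2} = mes E / √(2π); with the factor 1/√(2π) in the definition of F_E the printed value mes E is false (for E=[0,1] the norm is 1/√(2π)). *)

theory Defs
  imports "HOL-Analysis.Analysis"
begin

text \<open>
  The elements of the Hilbert space \<open>L\<^sup>2(M)\<close> are represented by functions; two representatives
  denote the same element iff they agree almost everywhere. Operators on \<open>L\<^sup>2(M)\<close> accordingly act
  on representatives, and all equations between their values are meant almost everywhere.
\<close>

definition L2 :: "'a measure \<Rightarrow> ('a \<Rightarrow> complex) set" where
  "L2 M = {f. f \<in> borel_measurable M \<and> integrable M (\<lambda>t. (cmod (f t))\<^sup>2)}"

definition L2_inner :: "'a measure \<Rightarrow> ('a \<Rightarrow> complex) \<Rightarrow> ('a \<Rightarrow> complex) \<Rightarrow> complex" where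
  "L2_inner M f g = integral\<^sup>L M (\<lambda>t. f t * cnj (g t))"

definition L2_norm :: "'a measure \<Rightarrow> ('a \<Rightarrow> complex) \<Rightarrow> real" where
  "L2_norm M f = sqrt (integral\<^sup>L M (\<lambda>t. (cmod (f t))\<^sup>2))"

definition L2_tendsto :: "'a measure \<Rightarrow> (nat \<Rightarrow> 'a \<Rightarrow> complex) \<Rightarrow> ('a \<Rightarrow> complex) \<Rightarrow> bool" where
  "L2_tendsto M X x \<longleftrightarrow>
     (\<forall>n. X n \<in> L2 M) \<and> x \<in> L2 M \<and> (\<lambda>n. L2_norm M (\<lambda>t. X n t - x t)) \<longlonglongrightarrow> 0"

definition bounded_operator_L2 ::
    "'a measure \<Rightarrow> (('a \<Rightarrow> complex) \<Rightarrow> ('a \<Rightarrow> complex)) \<Rightarrow> bool" where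
  "bounded_operator_L2 M T \<longleftrightarrow>
     (\<forall>x\<in>L2 M. T x \<in> L2 M) \<and>
     (\<forall>x\<in>L2 M. \<forall>y\<in>L2 M. (AE t in M. x t = y t) \<longrightarrow> (AE t in M. T x t = T y t)) \<and>
     (\<forall>x\<in>L2 M. \<forall>y\<in>L2 M. AE t in M. T (\<lambda>s. x s + y s) t = T x t + T y t) \<and>
     (\<forall>c. \<forall>x\<in>L2 M. AE t in M. T (\<lambda>s. c * x s) t = c * T x t) \<and>
     (\<exists>K. \<forall>x\<in>L2 M. L2_norm M (T x) \<le> K * L2_norm M x)"

text \<open>
  An orthonormal basis is an orthonormal system with dense linear span. Distinct members of
  \<open>B\<close> are orthogonal of norm 1, so no element of \<open>L\<^sup>2(M)\<close> has two representatives in \<open>B\<close>.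
\<close>

definition orthonormal_basis_L2 :: "'a measure \<Rightarrow> ('a \<Rightarrow> complex) set \<Rightarrow> bool" where
  "orthonormal_basis_L2 M B \<longleftrightarrow>
     B \<subseteq> L2 M \<and>
     (\<forall>f\<in>B. \<forall>g\<in>B. L2_inner M f g = (if f = g then 1 else 0)) \<and>
     (\<forall>x\<in>L2 M. \<forall>\<epsilon>>0. \<exists>F c. finite F \<and> F \<subseteq> B \<and>
        L2_norm M (\<lambda>t. x t - (\<Sum>f\<in>F. c f * f t)) < \<epsilon>)"

text \<open>
  The value of the sum \<open>\<Sum>f\<in>B. \<parallel>T f\<parallel>\<^sup>2\<close> does not depend on the orthonormal basis \<open>B\<close>; hence
  "for some basis" in the first definition and the choice of a basis in the second one.
\<close>

definition hilbert_schmidt_L2 ::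
    "'a measure \<Rightarrow> (('a \<Rightarrow> complex) \<Rightarrow> ('a \<Rightarrow> complex)) \<Rightarrow> bool" where
  "hilbert_schmidt_L2 M T \<longleftrightarrow> bounded_operator_L2 M T \<and>
     (\<exists>B. orthonormal_basis_L2 M B \<and> (\<lambda>f. (L2_norm M (T f))\<^sup>2) summable_on B)"

definition hilbert_schmidt_norm_L2 ::
    "'a measure \<Rightarrow> (('a \<Rightarrow> complex) \<Rightarrow> ('a \<Rightarrow> complex)) \<Rightarrow> real" where
  "hilbert_schmidt_norm_L2 M T =
     sqrt (\<Sum>\<^sub>\<infinity>f\<in>(SOME B. orthonormal_basis_L2 M B). (L2_norm M (T f))\<^sup>2)"

text \<open>
  \<open>fourier_integral E\<close> is used only for functions integrable over \<open>E\<close>, where it is an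
  absolutely convergent Lebesgue integral.
\<close>

definition fourier_integral :: "real set \<Rightarrow> (real \<Rightarrow> complex) \<Rightarrow> (real \<Rightarrow> complex)" where
  "fourier_integral E x t =
     complex_of_real (1 / sqrt (2 * pi)) *
     integral\<^sup>L (lebesgue_on E) (\<lambda>\<xi>. exp (\<i> * complex_of_real (t * \<xi>)) * x \<xi>)"

text \<open>
  The extension by continuity from \<open>L\<^sup>1(\<real>) \<inter> L\<^sup>2(\<real>)\<close> to \<open>L\<^sup>2(\<real>)\<close>: the value at \<open>x\<close> is the
  \<open>L\<^sup>2\<close>-limit, unique up to null sets, of the Fourier integrals of any sequence
  in \<open>L\<^sup>1(\<real>) \<inter> L\<^sup>2(\<real>)\<close> that converges to \<open>x\<close> in \<open>L\<^sup>2(\<real>)\<close>.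
\<close>

definition fourier_plancherel :: "(real \<Rightarrow> complex) \<Rightarrow> (real \<Rightarrow> complex)" where
  "fourier_plancherel x =
     (SOME y. \<forall>X. (\<forall>n. integrable lebesgue (X n)) \<and> L2_tendsto lebesgue X x \<longrightarrow>
        L2_tendsto lebesgue (\<lambda>n. fourier_integral UNIV (X n)) y)"

text \<open>
  An operator on \<open>L2 (lebesgue_on E)\<close>: values of \<open>x\<close> and of the result outside \<open>E\<close> are
  irrelevant, so the restriction to \<open>E\<close> of the transform needs no explicit mention.
  With the factor \<open>1 / sqrt (2 * pi)\<close> the kernel has constant modulus \<open>1 / sqrt (2 * pi)\<close>
  on \<open>E \<times> E\<close>, so that the Hilbert-Schmidt norm is \<open>mes E / sqrt (2 * pi)\<close>; it would be
  \<open>mes E\<close> for the kernel \<open>exp (\<i> t \<xi>)\<close> without that factor.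
\<close>

definition truncated_fourier :: "real set \<Rightarrow> (real \<Rightarrow> complex) \<Rightarrow> (real \<Rightarrow> complex)" where
  "truncated_fourier E x =
     (if emeasure lebesgue E < \<infinity> then fourier_integral E x
      else fourier_plancherel (\<lambda>\<xi>. if \<xi> \<in> E then x \<xi> else 0))"

end

theory Submission
  imports Defs "HOL-Probability.Probability"
begin

text \<open>
  If \<open>E\<close> has finite measure, the value of the transform of \<open>f\<close> at \<open>t\<close> is, up to the factor
  \<open>1 / sqrt (2 * pi)\<close>, the inner product of \<open>f\<close> with an exponential of squared norm \<open>mes E\<close>. Parseval's
  identity for each \<open>t \<in> E\<close>, integrated over \<open>E\<close>, gives the Hilbert-Schmidt norm.

  If \<open>E\<close> has infinite measure, cut \<open>E\<close> into cells of length \<open>1 / R\<close>. For \<open>\<bar>t\<bar> \<le> R\<close> the exponential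
  is almost constant on a cell \<open>A\<close>, so the transform of the normalised indicator function of \<open>A\<close> has
  squared modulus at least \<open>mes A / (8 * pi)\<close> at \<open>t\<close>. These functions are orthonormal, hence the sum of
  the squared norms of their transforms is at most the squared Hilbert-Schmidt norm. On the other
  hand it is at least \<open>mes (E \<inter> {-R..R}) * mes E / (8 * pi) = \<infinity>\<close>, a contradiction once \<open>R\<close> is
  large enough for \<open>E \<inter> {-R..R}\<close> to have positive measure. That the Fourier-Plancherel transform
  agrees with the Fourier integral on these functions rests on the inequality
  \<open>\<parallel>F h\<parallel> \<le> \<parallel>h\<parallel>\<close>, obtained by averaging \<open>\<bar>F h\<bar>\<^sup>2\<close> against Gaussian densities.
\<close>

subsection \<open>Orthonormal systems in square-integrable functions\<close>

lemma L2_integrable_mult_cnj: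
  assumes "f \<in> L2 M" "g \<in> L2 M"
  shows "integrable M (\<lambda>t. f t * cnj (g t))"
proof (rule Bochner_Integration.integrable_bound)
  show "integrable M (\<lambda>t. (cmod (f t))\<^sup>2 + (cmod (g t))\<^sup>2)"
    using assms by (auto simp: L2_def)
  have [measurable]: "f \<in> borel_measurable M" "g \<in> borel_measurable M"
    using assms by (auto simp: L2_def)
  show "(\<lambda>t. f t * cnj (g t)) \<in> borel_measurable M"
    by (intro borel_measurable_times borel_measurable_continuous_on[of cnj] continuous_intros) measurable
  have "a * b \<le> a\<^sup>2 + b\<^sup>2" for a b :: real
    using sum_squares_bound[of a b] zero_le_power2[of a] zero_le_power2[of b] by linarith
  then show "AE t in M. norm (f t * cnj (g t)) \<le> norm ((cmod (f t))\<^sup>2 + (cmod (g t))\<^sup>2)"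
    by (auto simp: norm_mult)
qed

lemma L2_scale: "f \<in> L2 M \<Longrightarrow> (\<lambda>t. c * f t) \<in> L2 M"
  by (auto simp: L2_def norm_mult power_mult_distrib)

lemma L2_add:
  assumes "f \<in> L2 M" "g \<in> L2 M"
  shows "(\<lambda>t. f t + g t) \<in> L2 M"
proof -
  have [measurable]: "f \<in> borel_measurable M" "g \<in> borel_measurable M"
    using assms by (auto simp: L2_def)
  have "integrable M (\<lambda>t. (cmod (f t + g t))\<^sup>2)"
  proof (rule Bochner_Integration.integrable_bound)
    show "integrable M (\<lambda>t. 2 * (cmod (f t))\<^sup>2 + 2 * (cmod (g t))\<^sup>2)"
      using assms by (auto simp: L2_def)
    have "(cmod (a + b))\<^sup>2 \<le> 2 * (cmod a)\<^sup>2 + 2 * (cmod b)\<^sup>2" for a b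
    proof -
      have "(cmod (a + b))\<^sup>2 \<le> (cmod a + cmod b)\<^sup>2"
        by (intro power_mono norm_triangle_ineq) auto
      also have "\<dots> \<le> 2 * (cmod a)\<^sup>2 + 2 * (cmod b)\<^sup>2"
        using sum_squares_bound[of "cmod a" "cmod b"] by (simp add: power2_sum)
      finally show ?thesis .
    qed
    then show "AE t in M. norm ((cmod (f t + g t))\<^sup>2) \<le> norm (2 * (cmod (f t))\<^sup>2 + 2 * (cmod (g t))\<^sup>2)"
      by auto
  qed measurable
  then show ?thesis
    by (simp add: L2_def)
qed

lemma L2_diff:
  assumes "f \<in> L2 M" "g \<in> L2 M"
  shows "(\<lambda>t. f t - g t) \<in> L2 M"
  using L2_add[OF assms(1) L2_scale[OF assms(2), of "-1"]] by simp

lemma L2_zero: "(\<lambda>t. 0) \<in> L2 M"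
  by (simp add: L2_def)

lemma L2_sum:
  assumes "\<And>i. i \<in> I \<Longrightarrow> f i \<in> L2 M"
  shows "(\<lambda>t. \<Sum>i\<in>I. f i t) \<in> L2 M"
  using assms
  by (induction I rule: infinite_finite_induct) (auto intro: L2_add L2_zero)

lemma L2_norm_nonneg: "0 \<le> L2_norm M f"
  by (simp add: L2_norm_def)

lemma L2_norm_power2: "(L2_norm M f)\<^sup>2 = (LINT t|M. (cmod (f t))\<^sup>2)"
  by (simp add: L2_norm_def)

lemma L2_norm_power2_inner: "complex_of_real ((L2_norm M f)\<^sup>2) = L2_inner M f f"
  unfolding L2_norm_power2 L2_inner_def
  by (simp add: complex_norm_square flip: integral_complex_of_real del: of_real_power)

lemma L2_inner_cnj: "cnj (L2_inner M f g) = L2_inner M g f"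
  unfolding L2_inner_def Bochner_Integration.integral_cnj[symmetric] by (simp add: mult.commute)

lemma L2_inner_diff_left:
  "f \<in> L2 M \<Longrightarrow> g \<in> L2 M \<Longrightarrow> h \<in> L2 M \<Longrightarrow>
    L2_inner M (\<lambda>t. f t - g t) h = L2_inner M f h - L2_inner M g h"
  by (simp add: L2_inner_def left_diff_distrib L2_integrable_mult_cnj)

lemma L2_inner_diff_right:
  "f \<in> L2 M \<Longrightarrow> g \<in> L2 M \<Longrightarrow> h \<in> L2 M \<Longrightarrow>
    L2_inner M h (\<lambda>t. f t - g t) = L2_inner M h f - L2_inner M h g"
  by (simp add: L2_inner_def right_diff_distrib L2_integrable_mult_cnj)

lemma L2_inner_sum_left:
  assumes "\<And>i. i \<in> I \<Longrightarrow> f i \<in> L2 M" "h \<in> L2 M"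
  shows "L2_inner M (\<lambda>t. \<Sum>i\<in>I. c i * f i t) h = (\<Sum>i\<in>I. c i * L2_inner M (f i) h)"
proof -
  have "L2_inner M (\<lambda>t. \<Sum>i\<in>I. c i * f i t) h = (LINT t|M. (\<Sum>i\<in>I. c i * (f i t * cnj (h t))))"
    by (simp add: L2_inner_def sum_distrib_right mult.assoc)
  also have "\<dots> = (\<Sum>i\<in>I. c i * L2_inner M (f i) h)"
    using assms by (subst Bochner_Integration.integral_sum) (auto simp: L2_inner_def L2_integrable_mult_cnj)
  finally show ?thesis .
qed

lemma L2_inner_sum_right:
  assumes "\<And>i. i \<in> I \<Longrightarrow> f i \<in> L2 M" "h \<in> L2 M"
  shows "L2_inner M h (\<lambda>t. \<Sum>i\<in>I. c i * f i t) = (\<Sum>i\<in>I. cnj (c i) * L2_inner M h (f i))"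
proof -
  have "L2_inner M h (\<lambda>t. \<Sum>i\<in>I. c i * f i t) = cnj (\<Sum>i\<in>I. c i * L2_inner M (f i) h)"
    using assms by (simp add: L2_inner_sum_left flip: L2_inner_cnj[of M _ h])
  also have "\<dots> = (\<Sum>i\<in>I. cnj (c i) * L2_inner M h (f i))"
    by (simp add: L2_inner_cnj)
  finally show ?thesis .
qed

text \<open>A triangle inequality for squares with a free weight \<open>d\<close>: the factor of the
  main term can be brought as close to 1 as desired, at the price of a large factor on the error
  term.\<close>

lemma L2_norm_add_power2_le:
  assumes f: "f \<in> L2 M" and g: "g \<in> L2 M" and d: "d > 0"
  shows "(L2_norm M (\<lambda>t. f t + g t))\<^sup>2 \<le> (1 + d) * (L2_norm M f)\<^sup>2 + (1 + 1 / d) * (L2_norm M g)\<^sup>2"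
proof -
  have le: "(cmod (a + b))\<^sup>2 \<le> (1 + d) * (cmod a)\<^sup>2 + (1 + 1 / d) * (cmod b)\<^sup>2" for a b
  proof -
    have "(cmod (a + b))\<^sup>2 \<le> (cmod a + cmod b)\<^sup>2"
      by (intro power_mono norm_triangle_ineq) auto
    also have "\<dots> = (1 + d) * (cmod a)\<^sup>2 + (1 + 1 / d) * (cmod b)\<^sup>2 - (d * cmod a - cmod b)\<^sup>2 / d"
      using d by (simp add: field_simps power2_eq_square)
    also have "\<dots> \<le> (1 + d) * (cmod a)\<^sup>2 + (1 + 1 / d) * (cmod b)\<^sup>2"
      using d by simp
    finally show ?thesis .
  qed
  have "(LINT t|M. (cmod (f t + g t))\<^sup>2) \<le> (LINT t|M. (1 + d) * (cmod (f t))\<^sup>2 + (1 + 1 / d) * (cmod (g t))\<^sup>2)"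
    using f g L2_add[OF f g] by (intro integral_mono le) (auto simp: L2_def)
  then show ?thesis
    using f g by (simp add: L2_norm_power2 L2_def)
qed

lemma L2_norm_cong_AE:
  assumes "f \<in> L2 M" "g \<in> L2 M" "AE t in M. f t = g t"
  shows "L2_norm M f = L2_norm M g"
proof -
  have "(LINT t|M. (cmod (f t))\<^sup>2) = (LINT t|M. (cmod (g t))\<^sup>2)"
    using assms by (intro integral_cong_AE) (auto simp: L2_def elim: eventually_mono)
  then show ?thesis
    by (simp add: L2_norm_def)
qed

text \<open>An indexed family is used instead of a set so that one notion covers both subsets of a
  basis, through \<open>\<lambda>f. f\<close>, and systems indexed by integers such as the
  normalised indicators of cells.\<close>

definition orthonormal_L2 :: "'a measure \<Rightarrow> ('i \<Rightarrow> 'a \<Rightarrow> complex) \<Rightarrow> 'i set \<Rightarrow> bool" where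
  "orthonormal_L2 M g I \<longleftrightarrow>
     (\<forall>i\<in>I. g i \<in> L2 M) \<and> (\<forall>i\<in>I. \<forall>j\<in>I. L2_inner M (g i) (g j) = (if i = j then 1 else 0))"

text \<open>Expand the square and complete it in each coefficient \<open>c i\<close>. The error is
  smallest at the Fourier coefficients, which gives Bessel's inequality and the best approximation
  property; taking the zero function for \<open>x\<close> gives Pythagoras' theorem.\<close>

lemma orthonormal_L2_approx:
  assumes I: "finite I" and g: "orthonormal_L2 M g I" and x: "x \<in> L2 M"
  shows "(L2_norm M (\<lambda>t. x t - (\<Sum>i\<in>I. c i * g i t)))\<^sup>2 =
    (L2_norm M x)\<^sup>2 - (\<Sum>i\<in>I. (cmod (L2_inner M x (g i)))\<^sup>2)
      + (\<Sum>i\<in>I. (cmod (c i - L2_inner M x (g i)))\<^sup>2)"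
proof -
  let ?s = "\<lambda>t. \<Sum>i\<in>I. c i * g i t"
  let ?a = "\<lambda>i. L2_inner M x (g i)"
  have gL: "\<And>i. i \<in> I \<Longrightarrow> g i \<in> L2 M"
    using g by (auto simp: orthonormal_L2_def)
  have s: "?s \<in> L2 M"
    by (intro L2_sum L2_scale gL)
  have xs: "L2_inner M x ?s = (\<Sum>i\<in>I. cnj (c i) * ?a i)"
    using gL x by (rule L2_inner_sum_right)
  have sx: "L2_inner M ?s x = (\<Sum>i\<in>I. c i * cnj (?a i))"
    using L2_inner_sum_left[of I g, OF gL x] by (simp add: L2_inner_cnj)
  have gs: "L2_inner M (g i) ?s = cnj (c i)" if "i \<in> I" for i
  proof -
    have "L2_inner M (g i) ?s = (\<Sum>j\<in>I. cnj (c j) * L2_inner M (g i) (g j))"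
      using gL that by (intro L2_inner_sum_right)
    also have "\<dots> = (\<Sum>j\<in>I. if i = j then cnj (c j) else 0)"
      using g that by (intro sum.cong) (auto simp: orthonormal_L2_def)
    finally show ?thesis
      using I that by simp
  qed
  have ss: "L2_inner M ?s ?s = (\<Sum>i\<in>I. c i * cnj (c i))"
    using L2_inner_sum_left[of I g, OF gL s] gs by simp
  have "complex_of_real ((L2_norm M (\<lambda>t. x t - ?s t))\<^sup>2) =
      L2_inner M x x - L2_inner M x ?s - (L2_inner M ?s x - L2_inner M ?s ?s)"
    using x s L2_diff[OF x s]
    by (simp only: L2_norm_power2_inner L2_inner_diff_left L2_inner_diff_right)
  also have "\<dots> = L2_inner M x x - (\<Sum>i\<in>I. cnj (c i) * ?a i + c i * cnj (?a i) - c i * cnj (c i))"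
    unfolding xs sx ss by (simp add: sum.distrib sum_subtractf)
  also have "\<dots> = L2_inner M x x - (\<Sum>i\<in>I. ?a i * cnj (?a i) - (c i - ?a i) * cnj (c i - ?a i))"
    by (intro arg_cong[where f = "(-) (L2_inner M x x)"] sum.cong refl) (simp add: algebra_simps)
  also have "\<dots> = complex_of_real ((L2_norm M x)\<^sup>2 - (\<Sum>i\<in>I. (cmod (?a i))\<^sup>2)
      + (\<Sum>i\<in>I. (cmod (c i - ?a i))\<^sup>2))"
    by (simp add: sum_subtractf complex_norm_square L2_norm_power2_inner del: complex_cnj_diff of_real_power)
  finally show ?thesis
    unfolding of_real_eq_iff .
qed

lemma Bessel_L2:
  assumes "finite I" "orthonormal_L2 M g I" "x \<in> L2 M"
  shows "(\<Sum>i\<in>I. (cmod (L2_inner M x (g i)))\<^sup>2) \<le> (L2_norm M x)\<^sup>2"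
  using orthonormal_L2_approx[OF assms, of "\<lambda>i. L2_inner M x (g i)"]
    zero_le_power2[of "L2_norm M (\<lambda>t. x t - (\<Sum>i\<in>I. L2_inner M x (g i) * g i t))"]
  by simp

lemma orthonormal_basis_imp_orthonormal_L2:
  "orthonormal_basis_L2 M B \<Longrightarrow> F \<subseteq> B \<Longrightarrow> orthonormal_L2 M (\<lambda>f. f) F"
  unfolding orthonormal_basis_L2_def orthonormal_L2_def by blast

text \<open>Density provides one good combination over some \<open>F\<close>. Passing to the Fourier
  coefficients and enlarging \<open>F\<close> to \<open>G\<close> can only shorten the distance. The
  uniformity in \<open>G\<close> matches the net behind \<open>has_sum\<close> and later lets one
  finite set serve several vectors.\<close>

lemma orthonormal_basis_L2_approx:
  assumes B: "orthonormal_basis_L2 M B" and x: "x \<in> L2 M" and e: "\<epsilon> > 0"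
  shows "\<exists>F. finite F \<and> F \<subseteq> B \<and> (\<forall>G. finite G \<and> F \<subseteq> G \<and> G \<subseteq> B \<longrightarrow>
    L2_norm M (\<lambda>t. x t - (\<Sum>f\<in>G. L2_inner M x f * f t)) < \<epsilon>)"
proof -
  obtain F c where F: "finite F" "F \<subseteq> B" and c: "L2_norm M (\<lambda>t. x t - (\<Sum>f\<in>F. c f * f t)) < \<epsilon>"
    using B x e unfolding orthonormal_basis_L2_def by blast
  have "L2_norm M (\<lambda>t. x t - (\<Sum>f\<in>G. L2_inner M x f * f t)) < \<epsilon>"
    if G: "finite G" "F \<subseteq> G" "G \<subseteq> B" for G
  proof -
    let ?a = "\<lambda>f. L2_inner M x f"
    have "(L2_norm M (\<lambda>t. x t - (\<Sum>f\<in>G. ?a f * f t)))\<^sup>2 = (L2_norm M x)\<^sup>2 - (\<Sum>f\<in>G. (cmod (?a f))\<^sup>2)"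
      using orthonormal_L2_approx[OF G(1) orthonormal_basis_imp_orthonormal_L2[OF B G(3)] x, of ?a]
      by simp
    also have "\<dots> \<le> (L2_norm M x)\<^sup>2 - (\<Sum>f\<in>F. (cmod (?a f))\<^sup>2)"
      using G by (simp add: sum_mono2)
    also have "\<dots> \<le> (L2_norm M (\<lambda>t. x t - (\<Sum>f\<in>F. c f * f t)))\<^sup>2"
      using orthonormal_L2_approx[OF F(1) orthonormal_basis_imp_orthonormal_L2[OF B F(2)] x, of c]
      by (simp add: sum_nonneg)
    finally have "L2_norm M (\<lambda>t. x t - (\<Sum>f\<in>G. ?a f * f t)) \<le> L2_norm M (\<lambda>t. x t - (\<Sum>f\<in>F. c f * f t))"
      by (rule power2_le_imp_le) (rule L2_norm_nonneg)
    with c show ?thesis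
      by simp
  qed
  with F show ?thesis
    by (intro exI[of _ F]) auto
qed

lemma Parseval_L2:
  assumes B: "orthonormal_basis_L2 M B" and x: "x \<in> L2 M"
  shows "((\<lambda>f. (cmod (L2_inner M x f))\<^sup>2) has_sum (L2_norm M x)\<^sup>2) B"
  unfolding has_sum_def tendsto_iff eventually_finite_subsets_at_top
proof (intro allI impI)
  fix e :: real assume e: "0 < e"
  \<comment> \<open>The tolerance is \<open>sqrt e\<close> because the deficit of a partial sum is
    the square of the distance from \<open>x\<close> to its projection.\<close>
  obtain F where F: "finite F" "F \<subseteq> B"
    "\<And>G. finite G \<Longrightarrow> F \<subseteq> G \<Longrightarrow> G \<subseteq> B \<Longrightarrow>
      L2_norm M (\<lambda>t. x t - (\<Sum>f\<in>G. L2_inner M x f * f t)) < sqrt e"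
    using orthonormal_basis_L2_approx[OF B x, of "sqrt e"] e by auto
  have "dist (\<Sum>f\<in>G. (cmod (L2_inner M x f))\<^sup>2) ((L2_norm M x)\<^sup>2) < e"
    if G: "finite G" "F \<subseteq> G" "G \<subseteq> B" for G
  proof -
    let ?r = "L2_norm M (\<lambda>t. x t - (\<Sum>f\<in>G. L2_inner M x f * f t))"
    have "?r\<^sup>2 = (L2_norm M x)\<^sup>2 - (\<Sum>f\<in>G. (cmod (L2_inner M x f))\<^sup>2)"
      using orthonormal_L2_approx[OF G(1) orthonormal_basis_imp_orthonormal_L2[OF B G(3)] x, of "\<lambda>f. L2_inner M x f"]
      by simp
    moreover have "?r\<^sup>2 < (sqrt e)\<^sup>2"
      using F(3)[OF G] by (intro power_strict_mono L2_norm_nonneg) auto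
    ultimately have "0 \<le> (L2_norm M x)\<^sup>2 - (\<Sum>f\<in>G. (cmod (L2_inner M x f))\<^sup>2)"
      "(L2_norm M x)\<^sup>2 - (\<Sum>f\<in>G. (cmod (L2_inner M x f))\<^sup>2) < e"
      using e zero_le_power2[of ?r] by (metis, metis less_imp_le real_sqrt_pow2)
    then show ?thesis
      unfolding dist_real_def by linarith
  qed
  then show "\<exists>X. finite X \<and> X \<subseteq> B \<and> (\<forall>Y. finite Y \<and> X \<subseteq> Y \<and> Y \<subseteq> B \<longrightarrow>
      dist (\<Sum>f\<in>Y. (cmod (L2_inner M x f))\<^sup>2) ((L2_norm M x)\<^sup>2) < e)"
    using F(1,2) by (intro exI[of _ F]) auto
qed

lemma le_of_le_add_mult:
  fixes a b c :: real
  assumes "\<And>e. e > 0 \<Longrightarrow> a \<le> b + c * e"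
  shows "a \<le> b"
proof (rule tendsto_lowerbound)
  show "((\<lambda>e. b + c * e) \<longlongrightarrow> b) (at_right 0)"
    by (auto intro!: tendsto_eq_intros)
  show "\<forall>\<^sub>F e in at_right 0. a \<le> b + c * e"
    using assms by (auto simp: eventually_at_filter)
qed simp

section \<open>Bounded operators and their Hilbert-Schmidt sums\<close>

lemma bounded_operator_L2D:
  assumes "bounded_operator_L2 M T"
  shows "x \<in> L2 M \<Longrightarrow> T x \<in> L2 M"
    and "x \<in> L2 M \<Longrightarrow> y \<in> L2 M \<Longrightarrow> AE t in M. T (\<lambda>s. x s + y s) t = T x t + T y t"
    and "x \<in> L2 M \<Longrightarrow> AE t in M. T (\<lambda>s. c * x s) t = c * T x t"
    and "\<exists>K. \<forall>x\<in>L2 M. L2_norm M (T x) \<le> K * L2_norm M x"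
  using assms by (simp_all add: bounded_operator_L2_def)

lemma bounded_operator_L2_sum:
  assumes T: "bounded_operator_L2 M T" and F: "F \<subseteq> L2 M"
  shows "AE t in M. T (\<lambda>s. \<Sum>f\<in>F. c f * f s) t = (\<Sum>f\<in>F. c f * T f t)"
  using F
proof (induction F rule: infinite_finite_induct)
  case (insert f F)
  have L: "(\<lambda>s. c f * f s) \<in> L2 M" "(\<lambda>s. \<Sum>f\<in>F. c f * f s) \<in> L2 M"
    using insert.prems by (auto intro!: L2_scale L2_sum)
  have "AE t in M. T (\<lambda>s. c f * f s + (\<Sum>f\<in>F. c f * f s)) t
      = T (\<lambda>s. c f * f s) t + T (\<lambda>s. \<Sum>f\<in>F. c f * f s) t"
    by (rule bounded_operator_L2D(2)[OF T L])
  moreover have "AE t in M. T (\<lambda>s. c f * f s) t = c f * T f t"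
    using insert.prems by (intro bounded_operator_L2D(3)[OF T]) auto
  moreover have "AE t in M. T (\<lambda>s. \<Sum>f\<in>F. c f * f s) t = (\<Sum>f\<in>F. c f * T f t)"
    using insert by blast
  ultimately show ?case
    by eventually_elim (simp add: insert.hyps)
next
  \<comment> \<open>Homogeneity with the scalar 0 sends the zero function to zero almost everywhere.
    This settles the empty sum and also the sum over an infinite set, whose value is 0 by
    convention.\<close>
  have "AE t in M. T (\<lambda>s. 0 * (0::complex)) t = 0 * T (\<lambda>s. 0) t"
    by (rule bounded_operator_L2D(3)[OF T L2_zero])
  then have "AE t in M. T (\<lambda>s. 0) t = 0"
    by simp
  {
    case (infinite F)
    show ?case using \<open>AE t in M. T (\<lambda>s. 0) t = 0\<close> infinite.hyps by simp
  next
    case empty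
    show ?case using \<open>AE t in M. T (\<lambda>s. 0) t = 0\<close> by simp
  }
qed

text \<open>
  For fixed \<open>t\<close>, the coefficients \<open>\<Sum>f\<in>F. \<langle>g i, f\<rangle> T f t\<close> are the conjugated coefficients of
  \<open>\<Sum>f\<in>F. cnj (T f t) f\<close>, so that Bessel's inequality applies pointwise and no adjoint is needed.
\<close>

lemma orthonormal_L2_change_of_basis:
  assumes I: "finite I" and g: "orthonormal_L2 M g I"
    and F: "finite F" and f: "orthonormal_L2 M (\<lambda>f. f) F"
    and T: "\<And>f. f \<in> F \<Longrightarrow> T f \<in> L2 M"
  shows "(\<Sum>i\<in>I. (L2_norm M (\<lambda>t. \<Sum>f\<in>F. L2_inner M (g i) f * T f t))\<^sup>2) \<le> (\<Sum>f\<in>F. (L2_norm M (T f))\<^sup>2)"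
proof -
  let ?p = "\<lambda>i t. \<Sum>f\<in>F. L2_inner M (g i) f * T f t"
  have fL: "\<And>f. f \<in> F \<Longrightarrow> f \<in> L2 M" and gL: "\<And>i. i \<in> I \<Longrightarrow> g i \<in> L2 M"
    using f g by (auto simp: orthonormal_L2_def)
  have pL: "?p i \<in> L2 M" for i
    by (intro L2_sum L2_scale T)
  have pointwise: "(\<Sum>i\<in>I. (cmod (?p i t))\<^sup>2) \<le> (\<Sum>f\<in>F. (cmod (T f t))\<^sup>2)" for t
  proof -
    let ?v = "\<lambda>s. \<Sum>f\<in>F. cnj (T f t) * f s"
    have v: "?v \<in> L2 M"
      by (intro L2_sum L2_scale fL)
    have "L2_inner M ?v (g i) = cnj (?p i t)" if "i \<in> I" for i
      using L2_inner_sum_left[of F "\<lambda>f. f", OF fL gL[OF that], where c = "\<lambda>f. cnj (T f t)"]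
      by (simp add: L2_inner_cnj mult.commute)
    then have "(\<Sum>i\<in>I. (cmod (?p i t))\<^sup>2) = (\<Sum>i\<in>I. (cmod (L2_inner M ?v (g i)))\<^sup>2)"
      by (simp del: cnj_sum)
    also have "\<dots> \<le> (L2_norm M ?v)\<^sup>2"
      by (rule Bessel_L2[OF I g v])
    \<comment> \<open>Pythagoras for \<open>?v\<close>, read off from the approximation identity at
      the zero function.\<close>
    also have "\<dots> = (\<Sum>f\<in>F. (cmod (T f t))\<^sup>2)"
      using orthonormal_L2_approx[OF F f L2_zero, of "\<lambda>f. cnj (T f t)"]
      by (simp add: L2_norm_power2 L2_inner_def)
    finally show ?thesis .
  qed
  have "(\<Sum>i\<in>I. (L2_norm M (?p i))\<^sup>2) = (LINT t|M. (\<Sum>i\<in>I. (cmod (?p i t))\<^sup>2))"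
    using pL by (simp add: L2_norm_power2 L2_def)
  also have "\<dots> \<le> (LINT t|M. (\<Sum>f\<in>F. (cmod (T f t))\<^sup>2))"
    using pL T by (intro integral_mono pointwise) (auto simp: L2_def)
  also have "\<dots> = (\<Sum>f\<in>F. (L2_norm M (T f))\<^sup>2)"
    using T by (simp add: L2_norm_power2 L2_def)
  finally show ?thesis .
qed

text \<open>Each \<open>g i\<close> is split into a partial Fourier sum \<open>p i\<close> over a
  finite set of basis elements and a small remainder \<open>r i\<close>. The images of the partial
  sums are controlled by \<open>orthonormal_L2_change_of_basis\<close>, those of the remainders by
  the boundedness of \<open>T\<close>.\<close>

lemma sum_orthonormal_L2_le_infsum:
  assumes T: "bounded_operator_L2 M T" and B: "orthonormal_basis_L2 M B"
    and S: "(\<lambda>f. (L2_norm M (T f))\<^sup>2) summable_on B"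
    and I: "finite I" and g: "orthonormal_L2 M g I"
  shows "(\<Sum>i\<in>I. (L2_norm M (T (g i)))\<^sup>2) \<le> (\<Sum>\<^sub>\<infinity>f\<in>B. (L2_norm M (T f))\<^sup>2)"
proof -
  let ?S = "\<Sum>\<^sub>\<infinity>f\<in>B. (L2_norm M (T f))\<^sup>2"
  have TL: "\<And>x. x \<in> L2 M \<Longrightarrow> T x \<in> L2 M" and BL: "B \<subseteq> L2 M"
    using bounded_operator_L2D(1)[OF T] B by (auto simp: orthonormal_basis_L2_def)
  obtain K where K: "\<And>x. x \<in> L2 M \<Longrightarrow> L2_norm M (T x) \<le> K * L2_norm M x"
    using bounded_operator_L2D(4)[OF T] by auto
  have gL: "\<And>i. i \<in> I \<Longrightarrow> g i \<in> L2 M"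
    using g by (auto simp: orthonormal_L2_def)
  \<comment> \<open>The limits are taken in this order, \<open>e\<close> to 0 for fixed
    \<open>d\<close> and then \<open>d\<close> to 0, since the factor of \<open>e\<close> contains
    \<open>1 / d\<close>.\<close>
  have "(\<Sum>i\<in>I. (L2_norm M (T (g i)))\<^sup>2) \<le> ?S + ?S * d" if d: "d > 0" for d
  proof (rule le_of_le_add_mult)
    fix e :: real assume e: "e > 0"
    have "\<forall>i\<in>I. \<exists>F. finite F \<and> F \<subseteq> B \<and> (\<forall>G. finite G \<and> F \<subseteq> G \<and> G \<subseteq> B \<longrightarrow>
      L2_norm M (\<lambda>t. g i t - (\<Sum>f\<in>G. L2_inner M (g i) f * f t)) < sqrt e)"
      using orthonormal_basis_L2_approx[OF B gL, of _ "sqrt e"] e by simp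
    from bchoice[OF this] obtain Fs where "\<forall>i\<in>I. finite (Fs i) \<and> Fs i \<subseteq> B \<and>
        (\<forall>G. finite G \<and> Fs i \<subseteq> G \<and> G \<subseteq> B \<longrightarrow>
          L2_norm M (\<lambda>t. g i t - (\<Sum>f\<in>G. L2_inner M (g i) f * f t)) < sqrt e)" ..
    then have Fs: "\<And>i. i \<in> I \<Longrightarrow> finite (Fs i)" "\<And>i. i \<in> I \<Longrightarrow> Fs i \<subseteq> B"
      "\<And>i G. i \<in> I \<Longrightarrow> finite G \<Longrightarrow> Fs i \<subseteq> G \<Longrightarrow> G \<subseteq> B \<Longrightarrow>
        L2_norm M (\<lambda>t. g i t - (\<Sum>f\<in>G. L2_inner M (g i) f * f t)) < sqrt e"
      by auto
    \<comment> \<open>The change of basis requires a single finite set for all \<open>i\<close>; the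
      union works because the approximations persist on larger sets.\<close>
    define F where "F = (\<Union>i\<in>I. Fs i)"
    have F: "finite F" "F \<subseteq> B"
      using Fs(1,2) I by (auto simp: F_def)
    then have FL: "F \<subseteq> L2 M"
      using BL by blast
    define p where "p i t = (\<Sum>f\<in>F. L2_inner M (g i) f * f t)" for i t
    define q where "q i t = (\<Sum>f\<in>F. L2_inner M (g i) f * T f t)" for i t
    define r where "r i t = g i t - p i t" for i t
    have pL: "p i \<in> L2 M" and qL: "q i \<in> L2 M" for i
      unfolding p_def q_def using FL by (auto intro!: L2_sum L2_scale TL)
    have rL: "r i \<in> L2 M" if "i \<in> I" for i
      unfolding r_def by (intro L2_diff gL that pL)
    have one: "(L2_norm M (T (g i)))\<^sup>2 \<le> (1 + d) * (L2_norm M (q i))\<^sup>2 + (1 + 1 / d) * (K\<^sup>2 * e)"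
      if i: "i \<in> I" for i
    proof -
      have "L2_norm M (r i) < sqrt e"
        unfolding r_def p_def using Fs(3)[OF i F(1) _ F(2)] i by (auto simp: F_def)
      then have "(L2_norm M (r i))\<^sup>2 \<le> e"
        using e L2_norm_nonneg[of M "r i"] by (metis less_imp_le real_sqrt_le_iff real_sqrt_unique)
      have "AE t in M. T (\<lambda>s. p i s + r i s) t = T (p i) t + T (r i) t"
        by (rule bounded_operator_L2D(2)[OF T pL rL[OF i]])
      moreover have "AE t in M. T (p i) t = q i t"
        using bounded_operator_L2_sum[OF T FL, of "\<lambda>f. L2_inner M (g i) f"] unfolding p_def q_def .
      moreover have "(\<lambda>s. p i s + r i s) = g i"
        by (simp add: r_def)
      ultimately have "AE t in M. T (g i) t = q i t + T (r i) t"
        by auto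
      then have "(L2_norm M (T (g i)))\<^sup>2 = (L2_norm M (\<lambda>t. q i t + T (r i) t))\<^sup>2"
        using L2_norm_cong_AE[OF TL[OF gL[OF i]] L2_add[OF qL TL[OF rL[OF i]]]] by simp
      also have "\<dots> \<le> (1 + d) * (L2_norm M (q i))\<^sup>2 + (1 + 1 / d) * (L2_norm M (T (r i)))\<^sup>2"
        by (intro L2_norm_add_power2_le qL TL rL i d)
      also have "\<dots> \<le> (1 + d) * (L2_norm M (q i))\<^sup>2 + (1 + 1 / d) * (K\<^sup>2 * e)"
      proof -
        have "(L2_norm M (T (r i)))\<^sup>2 \<le> (K * L2_norm M (r i))\<^sup>2"
          by (intro power_mono K rL i L2_norm_nonneg)
        also have "\<dots> \<le> K\<^sup>2 * e"
          using \<open>(L2_norm M (r i))\<^sup>2 \<le> e\<close> by (simp add: power_mult_distrib mult_left_mono)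
        finally show ?thesis
          using d by (intro add_left_mono mult_left_mono) auto
      qed
      finally show ?thesis .
    qed
    have "(\<Sum>i\<in>I. (L2_norm M (q i))\<^sup>2) \<le> (\<Sum>f\<in>F. (L2_norm M (T f))\<^sup>2)"
      unfolding q_def
      using FL by (intro orthonormal_L2_change_of_basis I g F TL
          orthonormal_basis_imp_orthonormal_L2[OF B]) auto
    also have "\<dots> \<le> ?S"
      by (intro finite_sum_le_infsum S F) auto
    finally have q: "(\<Sum>i\<in>I. (L2_norm M (q i))\<^sup>2) \<le> ?S" .
    have "(\<Sum>i\<in>I. (L2_norm M (T (g i)))\<^sup>2)
        \<le> (\<Sum>i\<in>I. (1 + d) * (L2_norm M (q i))\<^sup>2 + (1 + 1 / d) * (K\<^sup>2 * e))"
      by (intro sum_mono one)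
    also have "\<dots> = (1 + d) * (\<Sum>i\<in>I. (L2_norm M (q i))\<^sup>2) + card I * ((1 + 1 / d) * (K\<^sup>2 * e))"
      by (simp add: sum.distrib sum_distrib_left)
    also have "\<dots> \<le> (1 + d) * ?S + card I * ((1 + 1 / d) * (K\<^sup>2 * e))"
      using d q by (intro add_right_mono mult_left_mono) auto
    finally show "(\<Sum>i\<in>I. (L2_norm M (T (g i)))\<^sup>2) \<le> ?S + ?S * d + (card I * (1 + 1 / d) * K\<^sup>2) * e"
      by (simp add: algebra_simps)
  qed
  then show ?thesis
    by (rule le_of_le_add_mult)
qed

subsection \<open>The Fourier integral and Plancherel's inequality\<close>

text \<open>The completion inherits the cover of \<open>lborel\<close> by sets of finite measure.
  Fubini's theorem on the product of \<open>lebesgue\<close> with itself depends on it.\<close>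

lemma sigma_finite_lebesgue: "sigma_finite_measure (lebesgue :: 'a::euclidean_space measure)"
proof
  obtain A :: "'a set set" where "countable A" "A \<subseteq> sets lborel" "\<Union>A = space lborel"
    "\<forall>a\<in>A. emeasure lborel a \<noteq> \<infinity>"
    using lborel.sigma_finite_countable by blast
  then show "\<exists>A. countable A \<and> A \<subseteq> sets lebesgue \<and> \<Union>A = space (lebesgue :: 'a measure) \<and>
      (\<forall>a\<in>A. emeasure lebesgue a \<noteq> \<infinity>)"
    by (intro exI[of _ A]) (auto simp: subset_eq)
qed

lemma integrable_exp_mult:
  assumes "integrable (lebesgue_on E) x"
  shows "integrable (lebesgue_on E) (\<lambda>\<xi>. exp (\<i> * complex_of_real (t * \<xi>)) * x \<xi>)"
proof (rule Bochner_Integration.integrable_bound[OF assms])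
  have [measurable]: "x \<in> borel_measurable (lebesgue_on E)"
    using assms by auto
  have "(\<lambda>\<xi>. exp (\<i> * complex_of_real (t * \<xi>))) \<in> borel_measurable borel"
    by (intro borel_measurable_continuous_onI continuous_intros)
  then have [measurable]: "(\<lambda>\<xi>. exp (\<i> * complex_of_real (t * \<xi>))) \<in> borel_measurable (lebesgue_on E)"
    by (simp add: measurable_completion measurable_restrict_space1)
  show "(\<lambda>\<xi>. exp (\<i> * complex_of_real (t * \<xi>)) * x \<xi>) \<in> borel_measurable (lebesgue_on E)"
    by measurable
qed (simp add: norm_mult norm_exp_i_times del: of_real_mult)

lemma fourier_integral_diff:
  assumes "integrable (lebesgue_on E) x" "integrable (lebesgue_on E) y"
  shows "fourier_integral E (\<lambda>\<xi>. x \<xi> - y \<xi>) t = fourier_integral E x t - fourier_integral E y t"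
  using integrable_exp_mult[OF assms(1)] integrable_exp_mult[OF assms(2)]
  by (simp add: fourier_integral_def right_diff_distrib)

text \<open>Dominated convergence, with the modulus of \<open>x\<close> as majorant. Continuity
  yields measurability of the transform and later extends its vanishing from the rationals to the
  whole line.\<close>

lemma continuous_fourier_integral:
  assumes "integrable (lebesgue_on E) x"
  shows "continuous_on UNIV (fourier_integral E x)"
proof (rule continuous_on_sequentiallyI)
  fix u :: "nat \<Rightarrow> real" and a assume "u \<longlonglongrightarrow> a"
  then have lim: "(\<lambda>n. exp (\<i> * complex_of_real (u n * \<xi>)) * x \<xi>) \<longlonglongrightarrow> exp (\<i> * complex_of_real (a * \<xi>)) * x \<xi>" for \<xi>
    by (intro tendsto_intros)
  have "(\<lambda>n. LINT \<xi>|lebesgue_on E. exp (\<i> * complex_of_real (u n * \<xi>)) * x \<xi>)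
      \<longlonglongrightarrow> (LINT \<xi>|lebesgue_on E. exp (\<i> * complex_of_real (a * \<xi>)) * x \<xi>)"
  proof (rule integral_dominated_convergence)
    show "integrable (lebesgue_on E) (\<lambda>\<xi>. cmod (x \<xi>))"
      using assms by simp
    show "AE \<xi> in lebesgue_on E. norm (exp (\<i> * complex_of_real (u n * \<xi>)) * x \<xi>) \<le> cmod (x \<xi>)" for n
      by (simp add: norm_mult norm_exp_i_times del: of_real_mult)
  qed (use lim integrable_exp_mult[OF assms] in auto)
  then show "(\<lambda>n. fourier_integral E x (u n)) \<longlonglongrightarrow> fourier_integral E x a"
    unfolding fourier_integral_def by (intro tendsto_mult tendsto_const)
qed

lemma borel_measurable_fourier_integral:
  "integrable (lebesgue_on E) x \<Longrightarrow> fourier_integral E x \<in> borel_measurable borel"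
  by (intro borel_measurable_continuous_onI continuous_fourier_integral)

section \<open>Plancherel's inequality by Gaussian averaging\<close>

lemma char_std_normal_iexp:
  "(CLINT t|std_normal_distribution. iexp (t * u)) = complex_of_real (exp (- u\<^sup>2 / 2))"
  using fun_cong[OF char_std_normal_distribution, of u] by (simp add: char_def mult.commute)

text \<open>The squared modulus is a double integral over \<open>\<xi>\<close> and
  \<open>\<eta>\<close>. Integrating over \<open>t\<close> first replaces the oscillating factor by
  the Gaussian characteristic function at \<open>R * (\<xi> - \<eta>)\<close>, a multiple of a
  normal density in \<open>\<eta>\<close> centred at \<open>\<xi>\<close>. The product of the moduli
  of the two values of \<open>h\<close> is at most half the sum of their squares, and the density
  has total mass 1 in either variable.\<close>

lemma gaussian_average_fourier_integral:
  assumes h1: "integrable lebesgue h" and h2: "h \<in> L2 lebesgue" and R: "R > 0"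
  shows "(LINT t|std_normal_distribution. (cmod (fourier_integral UNIV h (R * t)))\<^sup>2)
    \<le> (L2_norm lebesgue h)\<^sup>2 / (R * sqrt (2 * pi))" (is "?lhs \<le> _")
proof -
  let ?N = std_normal_distribution and ?L = "lebesgue :: real measure"
  let ?P = "?L \<Otimes>\<^sub>M ?L"
  interpret N: prob_space ?N
    by (rule prob_space_normal_density) simp
  interpret L: sigma_finite_measure ?L
    by (rule sigma_finite_lebesgue)
  interpret P: pair_sigma_finite ?L ?L ..
  interpret P2: sigma_finite_measure "?L \<Otimes>\<^sub>M ?L"
    by unfold_locales
  interpret NP: pair_sigma_finite ?N "?L \<Otimes>\<^sub>M ?L" ..
  have [measurable]: "h \<in> borel_measurable ?L"
    using h1 by auto
  have id[measurable]: "(\<lambda>x. x) \<in> borel_measurable ?L"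
    by (simp add: measurable_completion)
  have [measurable]: "cnj \<in> borel_measurable borel"
    by (intro borel_measurable_continuous_onI continuous_intros)
  have [measurable]: "fst \<in> borel_measurable (?L \<Otimes>\<^sub>M ?L)" "snd \<in> borel_measurable (?L \<Otimes>\<^sub>M ?L)"
    by (auto intro: measurable_compose[OF measurable_fst id] measurable_compose[OF measurable_snd id])
  let ?H = "\<lambda>p. h (fst p) * cnj (h (snd p))"
  let ?w = "\<lambda>p. normal_density (fst p) (1 / R) (snd p)"
  let ?e = "\<lambda>t p. iexp (t * (R * (fst p - snd p)))"
  have H: "integrable (?L \<Otimes>\<^sub>M ?L) ?H"
    by (rule P.Fubini_integrable) (use h1 in \<open>auto simp: norm_mult\<close>)
  have eH: "integrable (?L \<Otimes>\<^sub>M ?L) (\<lambda>p. ?e t p * ?H p)" for t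
    by (rule Bochner_Integration.integrable_bound[OF H]) (auto simp: norm_mult simp del: of_real_mult of_real_diff)
  have NPH: "integrable (?N \<Otimes>\<^sub>M (?L \<Otimes>\<^sub>M ?L)) (\<lambda>(t, p). ?e t p * ?H p)"
    by (rule NP.Fubini_integrable) (use eH in \<open>auto simp: norm_mult simp del: of_real_mult of_real_diff\<close>)
  have sq: "complex_of_real (2 * pi * (cmod (fourier_integral UNIV h (R * t)))\<^sup>2) =
      (LINT p|?P. ?e t p * ?H p)" for t
  proof -
    let ?I = "LINT \<xi>|?L. iexp (R * t * \<xi>) * h \<xi>"
    have "fourier_integral UNIV h (R * t) = ?I / sqrt (2 * pi)"
      by (simp add: fourier_integral_def lebesgue_on_UNIV_eq)
    then have "2 * pi * (cmod (fourier_integral UNIV h (R * t)))\<^sup>2 = (cmod ?I)\<^sup>2"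
      by (simp add: norm_divide power_divide)
    then have "complex_of_real (2 * pi * (cmod (fourier_integral UNIV h (R * t)))\<^sup>2) = ?I * cnj ?I"
      by (simp only: complex_norm_square)
    also have "\<dots> = (LINT \<xi>|?L. LINT \<eta>|?L. (iexp (R * t * \<xi>) * h \<xi>) * cnj (iexp (R * t * \<eta>) * h \<eta>))"
      by (simp del: of_real_mult complex_cnj_mult)
    also have "\<dots> = (LINT \<xi>|?L. LINT \<eta>|?L. ?e t (\<xi>, \<eta>) * ?H (\<xi>, \<eta>))"
      by (intro Bochner_Integration.integral_cong refl)
        (simp add: exp_cnj exp_diff exp_minus field_simps flip: exp_add)
    also have "\<dots> = (LINT p|?P. ?e t p * ?H p)"
      by (rule P.integral_fst'[OF eH])
    finally show ?thesis .
  qed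
  have w: "exp (- (R * (fst p - snd p))\<^sup>2 / 2) = sqrt (2 * pi) / R * ?w p" for p
  proof -
    have "sqrt (2 * pi * (1 / R)\<^sup>2) = sqrt (2 * pi) / R"
      using R by (simp add: real_sqrt_mult real_sqrt_divide power_one_over)
    moreover have "- (snd p - fst p)\<^sup>2 / (2 * (1 / R)\<^sup>2) = - (R * (fst p - snd p))\<^sup>2 / 2"
      using R by (simp add: power_mult_distrib power2_commute[of "snd p"] power_one_over)
    ultimately show ?thesis
      using R by (simp add: normal_density_def)
  qed
  have "complex_of_real (2 * pi * ?lhs) = (LINT t|?N. LINT p|?P. ?e t p * ?H p)"
    unfolding sq[symmetric] by (simp del: of_real_mult)
  also have "\<dots> = (LINT p|?P. LINT t|?N. ?e t p * ?H p)"
    by (rule NP.Fubini_integral[symmetric]) (rule NPH)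
  also have "\<dots> = (LINT p|?P. complex_of_real (sqrt (2 * pi) / R * ?w p) * ?H p)"
    by (simp only: integral_mult_left_zero char_std_normal_iexp w)
  finally have eq: "complex_of_real (2 * pi * ?lhs) = \<dots>" .
  have nd: "integrable ?L (normal_density \<mu> (1 / R))" "integral\<^sup>L ?L (normal_density \<mu> (1 / R)) = 1" for \<mu>
    using R by (simp_all add: integrable_completion integral_completion)
  have w_measurable[measurable]: "?w \<in> borel_measurable ?P"
    unfolding normal_density_def by measurable
  have h2': "integrable ?L (\<lambda>\<xi>. (cmod (h \<xi>))\<^sup>2)"
    using h2 by (simp add: L2_def)
  have fst_int: "integrable (?L \<Otimes>\<^sub>M ?L) (\<lambda>p. (cmod (h (fst p)))\<^sup>2 * ?w p)"
    "(LINT p|?P. (cmod (h (fst p)))\<^sup>2 * ?w p) = (L2_norm lebesgue h)\<^sup>2"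
  proof -
    show int: "integrable ?P (\<lambda>p. (cmod (h (fst p)))\<^sup>2 * ?w p)"
      by (rule P.Fubini_integrable) (use nd h2' in \<open>auto simp: norm_mult\<close>)
    show "(LINT p|?P. (cmod (h (fst p)))\<^sup>2 * ?w p) = (L2_norm lebesgue h)\<^sup>2"
      using P.integral_fst'[OF int] nd by (simp add: L2_norm_power2)
  qed
  have snd_int: "integrable (?L \<Otimes>\<^sub>M ?L) (\<lambda>p. (cmod (h (snd p)))\<^sup>2 * ?w p)"
    "(LINT p|?P. (cmod (h (snd p)))\<^sup>2 * ?w p) = (L2_norm lebesgue h)\<^sup>2"
  proof -
    \<comment> \<open>A normal density is symmetric in its mean and its argument, so the integral
      with \<open>snd\<close> is the one with \<open>fst\<close> after exchanging the
      coordinates.\<close>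
    have swap: "(\<lambda>(\<xi>, \<eta>). (cmod (h (fst (\<eta>, \<xi>))))\<^sup>2 * ?w (\<eta>, \<xi>)) = (\<lambda>p. (cmod (h (snd p)))\<^sup>2 * ?w p)"
      by (auto simp: normal_density_def power2_commute)
    show "integrable ?P (\<lambda>p. (cmod (h (snd p)))\<^sup>2 * ?w p)"
      using P.integrable_product_swap[OF fst_int(1)] unfolding swap .
    show "(LINT p|?P. (cmod (h (snd p)))\<^sup>2 * ?w p) = (L2_norm lebesgue h)\<^sup>2"
      using P.integral_product_swap[of "\<lambda>p. (cmod (h (fst p)))\<^sup>2 * ?w p"] fst_int
      unfolding swap by simp
  qed
  have bound: "norm (complex_of_real (sqrt (2 * pi) / R * ?w p) * ?H p) \<le>
      sqrt (2 * pi) / R * (((cmod (h (fst p)))\<^sup>2 * ?w p + (cmod (h (snd p)))\<^sup>2 * ?w p) / 2)" for p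
  proof -
    have "norm (complex_of_real (sqrt (2 * pi) / R * ?w p) * ?H p)
        = sqrt (2 * pi) / R * ?w p * (cmod (h (fst p)) * cmod (h (snd p)))"
      using R by (simp add: norm_mult norm_divide)
    also have "\<dots> \<le> sqrt (2 * pi) / R * ?w p * (((cmod (h (fst p)))\<^sup>2 + (cmod (h (snd p)))\<^sup>2) / 2)"
      using R sum_squares_bound[of "cmod (h (fst p))" "cmod (h (snd p))"]
      by (intro mult_left_mono) auto
    also have "\<dots> = sqrt (2 * pi) / R * (((cmod (h (fst p)))\<^sup>2 * ?w p + (cmod (h (snd p)))\<^sup>2 * ?w p) / 2)"
      by (simp add: algebra_simps add_divide_distrib)
    finally show ?thesis .
  qed
  have "2 * pi * ?lhs = norm (complex_of_real (2 * pi * ?lhs))"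
    by (simp only: norm_of_real) (simp add: integral_nonneg_AE)
  also have "\<dots> \<le> (LINT p|?P. norm (complex_of_real (sqrt (2 * pi) / R * ?w p) * ?H p))"
    unfolding eq by (rule integral_norm_bound)
  also have "\<dots> \<le> (LINT p|?P.
      sqrt (2 * pi) / R * (((cmod (h (fst p)))\<^sup>2 * ?w p + (cmod (h (snd p)))\<^sup>2 * ?w p) / 2))"
    using fst_int snd_int by (intro integral_mono' bound order_trans[OF norm_ge_zero bound]) auto
  also have "\<dots> = sqrt (2 * pi) / R * (L2_norm lebesgue h)\<^sup>2"
    using fst_int snd_int by simp
  finally have "?lhs \<le> sqrt (2 * pi) / R * (L2_norm lebesgue h)\<^sup>2 / (2 * pi)"
    by (subst pos_le_divide_eq) (simp, simp only: mult.commute)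
  also have "\<dots> = (L2_norm lebesgue h)\<^sup>2 / (R * sqrt (2 * pi))"
    using R real_sqrt_pow2[of "2 * pi"] by (simp add: field_simps power2_eq_square)
  finally show ?thesis .
qed

text \<open>Substituting \<open>s = R * t\<close> in the Gaussian average bounds the integral of the
  squared transform against the weight \<open>exp (- (s / R)\<^sup>2 / 2)\<close> independently of
  \<open>R\<close>. The weight tends to 1 as \<open>R\<close> grows, and Fatou's lemma removes
  it.\<close>

lemma Plancherel_le:
  assumes h1: "integrable lebesgue h" and h2: "h \<in> L2 lebesgue"
  shows "fourier_integral UNIV h \<in> L2 lebesgue"
    and "L2_norm lebesgue (fourier_integral UNIV h) \<le> L2_norm lebesgue h"
proof -
  let ?F = "fourier_integral UNIV h"
  have meas[measurable]: "?F \<in> borel_measurable borel"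
    using h1 by (intro borel_measurable_fourier_integral) (simp add: lebesgue_on_UNIV_eq)
  have weighted: "(\<integral>\<^sup>+ s. ennreal ((cmod (?F s))\<^sup>2 * exp (- (s / R)\<^sup>2 / 2)) \<partial>lborel) \<le> ennreal ((L2_norm lebesgue h)\<^sup>2)"
    if R: "R > 0" for R
  proof -
    \<comment> \<open>The transform is bounded by a multiple of the integral of
      \<open>cmod (h \<xi>)\<close>, and the Gaussian measure is finite.\<close>
    have N: "integrable std_normal_distribution (\<lambda>t. (cmod (?F (R * t)))\<^sup>2)"
    proof -
      interpret N: prob_space std_normal_distribution
        by (rule prob_space_normal_density) simp
      have "cmod (?F t) \<le> 1 / sqrt (2 * pi) * (LINT \<xi>|lebesgue. cmod (h \<xi>))" for t
      proof -
        have "cmod (LINT \<xi>|lebesgue. iexp (t * \<xi>) * h \<xi>) \<le> (LINT \<xi>|lebesgue. cmod (iexp (t * \<xi>) * h \<xi>))"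
          by (rule integral_norm_bound)
        then show ?thesis
          by (simp add: fourier_integral_def lebesgue_on_UNIV_eq norm_mult norm_divide divide_right_mono
              del: of_real_mult)
      qed
      then have "(cmod (?F t))\<^sup>2 \<le> (1 / sqrt (2 * pi) * (LINT \<xi>|lebesgue. cmod (h \<xi>)))\<^sup>2" for t
        by (intro power_mono) auto
      then show ?thesis
        by (intro N.integrable_const_bound[where B = "(1 / sqrt (2 * pi) * (LINT \<xi>|lebesgue. cmod (h \<xi>)))\<^sup>2"]) auto
    qed
    have "(\<integral>\<^sup>+ s. ennreal ((cmod (?F s))\<^sup>2 * exp (- (s / R)\<^sup>2 / 2)) \<partial>lborel)
        = ennreal R * (\<integral>\<^sup>+ t. ennreal ((cmod (?F (R * t)))\<^sup>2 * exp (- t\<^sup>2 / 2)) \<partial>lborel)"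
      using R by (subst nn_integral_real_affine[where c = R and t = 0]) auto
    also have "(\<integral>\<^sup>+ t. ennreal ((cmod (?F (R * t)))\<^sup>2 * exp (- t\<^sup>2 / 2)) \<partial>lborel)
        = (\<integral>\<^sup>+ t. ennreal (sqrt (2 * pi)) * (ennreal (std_normal_density t) * ennreal ((cmod (?F (R * t)))\<^sup>2)) \<partial>lborel)"
      by (intro nn_integral_cong) (simp add: std_normal_density_def mult.commute flip: ennreal_mult')
    also have "\<dots> = ennreal (sqrt (2 * pi)) * (\<integral>\<^sup>+ t. ennreal ((cmod (?F (R * t)))\<^sup>2) \<partial>std_normal_distribution)"
      by (simp add: nn_integral_cmult nn_integral_density)
    also have "(\<integral>\<^sup>+ t. ennreal ((cmod (?F (R * t)))\<^sup>2) \<partial>std_normal_distribution)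
        = ennreal (LINT t|std_normal_distribution. (cmod (?F (R * t)))\<^sup>2)"
      by (intro nn_integral_eq_integral N) auto
    also have "ennreal R * (ennreal (sqrt (2 * pi)) * \<dots>)
        \<le> ennreal R * (ennreal (sqrt (2 * pi)) * ennreal ((L2_norm lebesgue h)\<^sup>2 / (R * sqrt (2 * pi))))"
      by (intro mult_left_mono ennreal_leI gaussian_average_fourier_integral h1 h2 R) auto
    also have "\<dots> = ennreal ((L2_norm lebesgue h)\<^sup>2)"
      using R by (simp flip: ennreal_mult')
    finally show ?thesis .
  qed
  have "(\<integral>\<^sup>+ s. ennreal ((cmod (?F s))\<^sup>2) \<partial>lborel)
      = (\<integral>\<^sup>+ s. liminf (\<lambda>n. ennreal ((cmod (?F s))\<^sup>2 * exp (- (s / real (Suc n))\<^sup>2 / 2))) \<partial>lborel)"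
  proof (intro nn_integral_cong lim_imp_Liminf[symmetric] tendsto_ennrealI)
    fix s
    have "(\<lambda>n. s / real (Suc n)) \<longlonglongrightarrow> 0"
      by (rule LIMSEQ_Suc) (rule lim_const_over_n)
    then have "(\<lambda>n. (cmod (?F s))\<^sup>2 * exp (- (s / real (Suc n))\<^sup>2 / 2)) \<longlonglongrightarrow> (cmod (?F s))\<^sup>2 * exp (- 0\<^sup>2 / 2)"
      by (intro tendsto_intros) auto
    then show "(\<lambda>n. (cmod (?F s))\<^sup>2 * exp (- (s / real (Suc n))\<^sup>2 / 2)) \<longlonglongrightarrow> (cmod (?F s))\<^sup>2"
      by simp
  qed simp
  also have "\<dots> \<le> liminf (\<lambda>n. \<integral>\<^sup>+ s. ennreal ((cmod (?F s))\<^sup>2 * exp (- (s / real (Suc n))\<^sup>2 / 2)) \<partial>lborel)"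
    by (rule nn_integral_liminf) simp
  also have "\<dots> \<le> ennreal ((L2_norm lebesgue h)\<^sup>2)"
    by (intro Liminf_le always_eventually allI weighted) auto
  finally have le: "(\<integral>\<^sup>+ s. ennreal ((cmod (?F s))\<^sup>2) \<partial>lebesgue) \<le> ennreal ((L2_norm lebesgue h)\<^sup>2)"
    by (simp add: nn_integral_completion)
  have F: "?F \<in> borel_measurable lebesgue"
    using meas by (simp add: measurable_completion)
  have int: "integrable lebesgue (\<lambda>s. (cmod (?F s))\<^sup>2)"
    using F le by (intro integrableI_bounded) (auto intro: le_less_trans)
  then show "?F \<in> L2 lebesgue"
    using F by (simp add: L2_def)
  have "ennreal ((L2_norm lebesgue ?F)\<^sup>2) \<le> ennreal ((L2_norm lebesgue h)\<^sup>2)"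
    using le int by (simp add: L2_norm_power2 nn_integral_eq_integral)
  then have "(L2_norm lebesgue ?F)\<^sup>2 \<le> (L2_norm lebesgue h)\<^sup>2"
    by simp
  then show "L2_norm lebesgue ?F \<le> L2_norm lebesgue h"
    by (rule power2_le_imp_le) (rule L2_norm_nonneg)
qed

section \<open>The Fourier-Plancherel transform of integrable functions\<close>

lemma L2_norm_eq_0_imp_AE:
  assumes "f \<in> L2 M" "L2_norm M f = 0"
  shows "AE t in M. f t = 0"
proof -
  have "(LINT t|M. (cmod (f t))\<^sup>2) = 0"
    using assms(2) by (simp flip: L2_norm_power2)
  then show ?thesis
    using assms(1) integral_nonneg_eq_0_iff_AE[of M "\<lambda>t. (cmod (f t))\<^sup>2"] by (simp add: L2_def)
qed

text \<open>The choice in \<open>fourier_plancherel\<close> is meaningful once some function has the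
  defining property. The Fourier integral of \<open>x\<close> has it, by
  \<open>Plancherel_le\<close> applied to the differences of \<open>X n\<close> and
  \<open>x\<close>. Testing the chosen function on the constant sequence \<open>x\<close> then
  identifies the two.\<close>

lemma fourier_plancherel_eq_fourier_integral:
  assumes x1: "integrable lebesgue x" and x2: "x \<in> L2 lebesgue"
  shows "AE t in lebesgue. fourier_plancherel x t = fourier_integral UNIV x t"
proof -
  let ?F = "fourier_integral UNIV"
  let ?P = "\<lambda>y. \<forall>X. (\<forall>n. integrable lebesgue (X n)) \<and> L2_tendsto lebesgue X x \<longrightarrow>
    L2_tendsto lebesgue (\<lambda>n. ?F (X n)) y"
  have "?P (?F x)"
  proof (intro allI impI; elim conjE)
    fix X assume X1: "\<forall>n. integrable lebesgue (X n)" and "L2_tendsto lebesgue X x"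
    then have X2: "\<And>n. X n \<in> L2 lebesgue" and lim: "(\<lambda>n. L2_norm lebesgue (\<lambda>t. X n t - x t)) \<longlonglongrightarrow> 0"
      by (auto simp: L2_tendsto_def)
    have "L2_norm lebesgue (\<lambda>t. ?F (X n) t - ?F x t) \<le> L2_norm lebesgue (\<lambda>t. X n t - x t)" for n
    proof -
      have "(\<lambda>t. ?F (X n) t - ?F x t) = ?F (\<lambda>t. X n t - x t)"
        using X1 x1 by (intro ext fourier_integral_diff[symmetric]) (auto simp: lebesgue_on_UNIV_eq)
      then show ?thesis
        using X1 x1 Plancherel_le(2)[of "\<lambda>t. X n t - x t"] L2_diff[OF X2 x2] by simp
    qed
    then have "(\<lambda>n. L2_norm lebesgue (\<lambda>t. ?F (X n) t - ?F x t)) \<longlonglongrightarrow> 0"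
      by (intro tendsto_sandwich[OF _ _ tendsto_const lim]) (auto simp: L2_norm_nonneg)
    then show "L2_tendsto lebesgue (\<lambda>n. ?F (X n)) (?F x)"
      using X1 X2 x1 x2 by (simp add: L2_tendsto_def Plancherel_le(1))
  qed
  then have "?P (fourier_plancherel x)"
    unfolding fourier_plancherel_def by (rule someI[of ?P])
  moreover have "L2_tendsto lebesgue (\<lambda>n. x) x"
    using x2 by (simp add: L2_tendsto_def L2_norm_def)
  ultimately have "L2_tendsto lebesgue (\<lambda>n. ?F x) (fourier_plancherel x)"
    using x1 by simp
  then have "fourier_plancherel x \<in> L2 lebesgue"
    and "L2_norm lebesgue (\<lambda>t. ?F x t - fourier_plancherel x t) = 0"
    by (auto simp: L2_tendsto_def LIMSEQ_const_iff)
  then have "AE t in lebesgue. ?F x t - fourier_plancherel x t = 0"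
    using Plancherel_le(1)[OF x1 x2] by (intro L2_norm_eq_0_imp_AE L2_diff)
  then show ?thesis
    by eventually_elim simp
qed

subsection \<open>Sets of finite measure\<close>

text \<open>Makes Tonelli's theorem available for sums over a basis: as an integral over counting
  measure, such a sum can be exchanged with an integral over \<open>E\<close>.\<close>

lemma has_sum_iff_nn_integral_count_space:
  fixes f :: "'a \<Rightarrow> real"
  assumes f: "\<And>x. x \<in> A \<Longrightarrow> 0 \<le> f x" and s: "0 \<le> s"
  shows "(f has_sum s) A \<longleftrightarrow> (\<integral>\<^sup>+ x. ennreal (f x) \<partial>count_space A) = ennreal s"
proof
  assume sum: "(f has_sum s) A"
  then have "(\<lambda>x. norm (f x)) summable_on A"
    by (intro summable_on_iff_abs_summable_on_real[THEN iffD1] has_sum_imp_summable)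
  then have abs: "Infinite_Set_Sum.abs_summable_on f A"
    by (simp only: abs_summable_equivalent)
  show "(\<integral>\<^sup>+ x. ennreal (f x) \<partial>count_space A) = ennreal s"
    using nn_integral_conv_infsetsum[OF abs f] infsetsum_infsum[OF abs] infsumI[OF sum] by simp
next
  assume int: "(\<integral>\<^sup>+ x. ennreal (f x) \<partial>count_space A) = ennreal s"
  have "integrable (count_space A) f"
    by (rule integrableI_nn_integral_finite[OF _ _ int]) (use f s in \<open>auto simp: AE_count_space\<close>)
  then have abs: "Infinite_Set_Sum.abs_summable_on f A"
    by (simp add: Infinite_Set_Sum.abs_summable_on_def)
  then have "(\<lambda>x. norm (f x)) summable_on A"
    by (simp only: abs_summable_equivalent)
  then have "f summable_on A"
    by (rule summable_on_iff_abs_summable_on_real[THEN iffD2])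
  moreover have "infsum f A = s"
    using nn_integral_conv_infsetsum[OF abs f] infsetsum_infsum[OF abs] int s
    by (simp add: infsum_nonneg f)
  ultimately show "(f has_sum s) A"
    by (simp add: has_sum_iff)
qed

lemma fourier_integral_eq_L2_inner:
  "fourier_integral E x t = complex_of_real (1 / sqrt (2 * pi)) * L2_inner (lebesgue_on E) x (\<lambda>\<xi>. iexp (- (t * \<xi>)))"
  by (simp add: fourier_integral_def L2_inner_def exp_cnj mult.commute)

text \<open>Stated for an arbitrary orthonormal basis, so that it applies to whichever one the
  definition of the norm selects.\<close>

lemma orthonormal_basis_fourier_integral_has_sum:
  assumes E: "E \<in> sets lebesgue" and fin: "emeasure lebesgue E < \<infinity>"
    and B: "orthonormal_basis_L2 (lebesgue_on E) B"
  shows "((\<lambda>f. (L2_norm (lebesgue_on E) (fourier_integral E f))\<^sup>2) has_sum (measure lebesgue E)\<^sup>2 / (2 * pi)) B"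
proof -
  let ?M = "lebesgue_on E" and ?F = "fourier_integral E"
  define m where "m = measure lebesgue E"
  have m: "emeasure ?M (space ?M) = ennreal m" "measure ?M (space ?M) = m"
  proof -
    have "emeasure ?M (space ?M) = emeasure lebesgue E"
      using E by (simp add: emeasure_restrict_space)
    also have "\<dots> = ennreal m"
      unfolding m_def using fin by (intro emeasure_eq_ennreal_measure) auto
    finally show "emeasure ?M (space ?M) = ennreal m" .
    show "measure ?M (space ?M) = m"
      using E by (simp add: m_def measure_restrict_space)
  qed
  interpret finite_measure ?M
    by standard (simp only: m, simp)
  have m0: "0 \<le> m"
    by (simp add: m_def)
  let ?e = "\<lambda>t \<xi>. iexp (- (t * \<xi>))"
  have id[measurable]: "(\<lambda>x. x) \<in> borel_measurable ?M"
    by (simp add: measurable_completion measurable_restrict_space1)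
  have e: "?e t \<in> L2 ?M" for t
    by (simp add: L2_def del: of_real_mult of_real_minus)
  have norm_e: "(L2_norm ?M (?e t))\<^sup>2 = m" for t
    using m by (simp add: L2_norm_power2 del: of_real_mult of_real_minus)
  have L1: "integrable ?M f" if "f \<in> L2 ?M" for f
    using L2_integrable_mult_cnj[OF that, of "\<lambda>_. 1"] by (simp add: L2_def)
  have BL: "f \<in> L2 ?M" if "f \<in> B" for f
    using B that by (auto simp: orthonormal_basis_L2_def)
  have F_cont: "continuous_on UNIV (?F f)" if "f \<in> B" for f
    by (intro continuous_fourier_integral L1 BL that)
  have F_meas: "?F f \<in> borel_measurable ?M" if "f \<in> B" for f
    using borel_measurable_fourier_integral[OF L1[OF BL[OF that]]]
    by (simp add: measurable_completion measurable_restrict_space1)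
  have pointwise: "((\<lambda>f. (cmod (?F f t))\<^sup>2) has_sum m / (2 * pi)) B" for t
  proof -
    \<comment> \<open>The modulus ignores the order of the arguments of the inner product. Up to the
      constant factor, the squared transforms at \<open>t\<close> are therefore the squared
      coefficients of the exponential \<open>?e t\<close>, to which Parseval's identity
      applies.\<close>
    have "(cmod (?F f t))\<^sup>2 = 1 / (2 * pi) * (cmod (L2_inner ?M (?e t) f))\<^sup>2" for f
      using complex_mod_cnj[of "L2_inner ?M f (?e t)"]
      by (simp add: fourier_integral_eq_L2_inner L2_inner_cnj norm_mult norm_divide power_divide)
    then show ?thesis
      using has_sum_cmult_right[OF Parseval_L2[OF B e[of t]], of "1 / (2 * pi)"] norm_e by simp
  qed
  \<comment> \<open>\<open>B\<close> is not known to be countable, whereas sum and integral are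
    exchanged over a countable set. At each rational the summable family has only countably many
    nonzero terms; for a basis function outside \<open>C\<close> the transform vanishes at all
    rationals, hence everywhere by continuity.\<close>
  define C where "C = (\<Union>q\<in>\<rat>. {f \<in> B. (cmod (?F f q))\<^sup>2 \<noteq> 0})"
  have C: "countable C"
    unfolding C_def
    by (intro countable_UN countable_rat summable_countable_real has_sum_imp_summable[OF pointwise])
  have CB: "C \<subseteq> B"
    by (auto simp: C_def)
  have vanish: "?F f t = 0" if f: "f \<in> B - C" for f t
  proof (rule continuous_constant_on_closure[of "\<rat>" "?F f"])
    show "continuous_on (closure \<rat>) (?F f)"
      using F_cont f by (simp add: Rats_closure_real)
    show "?F f q = 0" if "q \<in> \<rat>" for q
      using f that by (auto simp: C_def)
  qed (simp add: Rats_closure_real)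
  have "((\<lambda>f. (cmod (?F f t))\<^sup>2) has_sum m / (2 * pi)) C" for t
    using pointwise[of t] vanish CB
    by (subst has_sum_cong_neutral[where T = B and g = "\<lambda>f. (cmod (?F f t))\<^sup>2"]) auto
  then have "(\<integral>\<^sup>+ f. ennreal ((cmod (?F f t))\<^sup>2) \<partial>count_space C) = ennreal (m / (2 * pi))" for t
    using m0 by (subst has_sum_iff_nn_integral_count_space[symmetric]) auto
  then have "(\<integral>\<^sup>+ t. \<integral>\<^sup>+ f. ennreal ((cmod (?F f t))\<^sup>2) \<partial>count_space C \<partial>?M) = ennreal (m / (2 * pi)) * ennreal m"
    by (simp only: nn_integral_const m)
  also have "\<dots> = ennreal (m\<^sup>2 / (2 * pi))"
    using m0 by (simp add: power2_eq_square flip: ennreal_mult')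
  also have "(\<integral>\<^sup>+ t. \<integral>\<^sup>+ f. ennreal ((cmod (?F f t))\<^sup>2) \<partial>count_space C \<partial>?M)
      = (\<integral>\<^sup>+ f. \<integral>\<^sup>+ t. ennreal ((cmod (?F f t))\<^sup>2) \<partial>?M \<partial>count_space C)"
    using F_meas CB by (intro nn_integral_count_space_nn_integral C) auto
  also have "\<dots> = (\<integral>\<^sup>+ f. ennreal ((L2_norm ?M (?F f))\<^sup>2) \<partial>count_space C)"
  proof (intro nn_integral_cong)
    fix f assume "f \<in> space (count_space C)"
    then have f: "f \<in> B"
      using CB by auto
    \<comment> \<open>One term is at most the whole sum, so the transform is bounded and therefore
      square-integrable over a set of finite measure.\<close>
    have "(cmod (?F f t))\<^sup>2 \<le> m / (2 * pi)" for t
      using finite_sum_le_has_sum[OF pointwise, of "{f}" t] f by simp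
    then have "integrable ?M (\<lambda>t. (cmod (?F f t))\<^sup>2)"
      using F_meas[OF f] by (intro integrable_const_bound[where B = "m / (2 * pi)"]) auto
    then show "(\<integral>\<^sup>+ t. ennreal ((cmod (?F f t))\<^sup>2) \<partial>?M) = ennreal ((L2_norm ?M (?F f))\<^sup>2)"
      by (simp add: L2_norm_power2 nn_integral_eq_integral)
  qed
  finally have "((\<lambda>f. (L2_norm ?M (?F f))\<^sup>2) has_sum m\<^sup>2 / (2 * pi)) C"
    using m0 by (subst has_sum_iff_nn_integral_count_space) auto
  moreover have "(L2_norm ?M (?F f))\<^sup>2 = 0" if "f \<in> B - C" for f
    using vanish[OF that] by (simp add: L2_norm_def)
  ultimately show ?thesis
    unfolding m_def using CB
    by (subst has_sum_cong_neutral[where T = C and g = "\<lambda>f. (L2_norm ?M (?F f))\<^sup>2"]) auto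
qed

subsection \<open>Sets of infinite measure\<close>

text \<open>The cosine of \<open>u\<close> is 1 minus twice the square of
  \<open>sin (u / 2)\<close>, and that sine has modulus at most 1/2.\<close>

lemma cos_ge_half:
  assumes "\<bar>u\<bar> \<le> (1::real)"
  shows "1 / 2 \<le> cos u"
proof -
  have "\<bar>sin (u / 2)\<bar> \<le> 1 / 2"
    using abs_sin_x_le_abs_x[of "u / 2"] assms by simp
  then have "(sin (u / 2))\<^sup>2 \<le> (1 / 2)\<^sup>2"
    by (metis abs_ge_zero power2_abs power_mono)
  then show ?thesis
    using cos_double_sin[of "u / 2"] by (simp add: power2_eq_square)
qed

lemma integrable_indicator_complex:
  assumes "A \<in> fmeasurable M"
  shows "integrable M (indicator A :: 'a \<Rightarrow> complex)"
proof -
  have "integrable M (\<lambda>x. complex_of_real (indicator A x))"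
    using assms by (intro integrable_of_real) (auto simp: fmeasurable_def)
  moreover have "(\<lambda>x. complex_of_real (indicator A x)) = indicator A"
    by (auto simp: indicator_def)
  ultimately show ?thesis
    by simp
qed

lemma floor_cell_sets_lebesgue: "{x::real. \<lfloor>x * R\<rfloor> = k} \<in> sets lebesgue"
proof -
  have "{x::real. \<lfloor>x * R\<rfloor> = k} \<in> sets borel"
    unfolding floor_eq_iff by measurable
  then show ?thesis
    by auto
qed

lemma L2_restrict_space:
  assumes E: "E \<in> sets M" and f: "f \<in> L2 M"
  shows "f \<in> L2 (restrict_space M E)"
proof -
  have "integrable M (\<lambda>t. indicator E t *\<^sub>R (cmod (f t))\<^sup>2)"
    using f by (intro integrable_mult_indicator E) (simp add: L2_def)
  then show ?thesis
    using E f by (simp add: L2_def measurable_restrict_space1 integrable_restrict_space)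
qed

lemma fourier_integral_cmult:
  "fourier_integral E (\<lambda>\<xi>. c * x \<xi>) t = c * fourier_integral E x t"
proof -
  have "(LINT \<xi>|lebesgue_on E. iexp (t * \<xi>) * (c * x \<xi>)) = (LINT \<xi>|lebesgue_on E. c * (iexp (t * \<xi>) * x \<xi>))"
    by (intro Bochner_Integration.integral_cong refl mult.left_commute)
  then show ?thesis
    by (simp only: fourier_integral_def integral_mult_right_zero) (rule mult.left_commute)
qed

text \<open>On a set of small diameter the exponential hardly oscillates, so no cancellation occurs.\<close>

lemma fourier_integral_indicator_ge:
  assumes A: "A \<in> lmeasurable"
    and small: "\<And>\<xi>. \<xi> \<in> A \<Longrightarrow> \<bar>t * (\<xi> - a)\<bar> \<le> 1"
  shows "measure lebesgue A / (2 * sqrt (2 * pi)) \<le> cmod (fourier_integral UNIV (indicator A) t)"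
proof -
  have ind: "integrable lebesgue (indicator A :: real \<Rightarrow> real)" "integrable lebesgue (indicator A :: real \<Rightarrow> complex)"
    using A by (auto intro: integrable_indicator_complex simp: fmeasurable_def)
  let ?J = "LINT \<xi>|lebesgue. iexp (t * \<xi>) * indicator A \<xi>"
  have int: "integrable lebesgue (\<lambda>\<xi>. iexp (t * \<xi>) * indicator A \<xi>)"
    using integrable_exp_mult[of UNIV "indicator A" t] ind by (simp add: lebesgue_on_UNIV_eq)
  \<comment> \<open>Multiplying by the unimodular constant \<open>iexp (- (t * a))\<close> recentres
    the phase at \<open>a\<close> without changing the modulus of the integral. On \<open>A\<close>
    the phase then lies between -1 and 1, where the cosine is at least 1/2.\<close>
  have eq: "iexp (- (t * a)) * (iexp (t * \<xi>) * indicator A \<xi>) = iexp (t * (\<xi> - a)) * indicator A \<xi>" for \<xi>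
    by (simp add: right_diff_distrib flip: exp_add mult.assoc)
  have Re_eq: "Re (iexp (t * (\<xi> - a)) * indicator A \<xi>) = cos (t * (\<xi> - a)) * indicator A \<xi>" for \<xi>
    by (simp add: Re_exp split: split_indicator)
  have int': "integrable lebesgue (\<lambda>\<xi>. iexp (t * (\<xi> - a)) * indicator A \<xi>)"
    unfolding eq[symmetric] by (intro integrable_mult_right int)
  have "measure lebesgue A / 2 = (LINT \<xi>|lebesgue. 1 / 2 * indicator A \<xi>)"
    by simp
  also have "\<dots> \<le> (LINT \<xi>|lebesgue. Re (iexp (t * (\<xi> - a)) * indicator A \<xi>))"
  proof (rule integral_mono)
    show "integrable lebesgue (\<lambda>\<xi>. Re (iexp (t * (\<xi> - a)) * indicator A \<xi>))"
      by (rule integrable_Re[OF int'])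
    show "1 / 2 * indicator A \<xi> \<le> Re (iexp (t * (\<xi> - a)) * indicator A \<xi>)" for \<xi>
      unfolding Re_eq using cos_ge_half[OF small, of \<xi>] by (simp split: split_indicator)
  qed (use ind in simp)
  also have "\<dots> = Re (iexp (- (t * a)) * ?J)"
    by (subst integral_Re[OF int']) (simp only: eq[symmetric] integral_mult_right_zero)
  also have "\<dots> \<le> cmod (iexp (- (t * a)) * ?J)"
    by (rule complex_Re_le_cmod)
  also have "\<dots> = cmod ?J"
    by (simp only: norm_mult norm_exp_i_times mult_1)
  finally have "measure lebesgue A / 2 \<le> cmod ?J" .
  then have "measure lebesgue A / 2 / sqrt (2 * pi) \<le> cmod ?J / sqrt (2 * pi)"
    by (rule divide_right_mono) simp
  then show ?thesis
    by (simp add: fourier_integral_def lebesgue_on_UNIV_eq norm_mult norm_divide del: of_real_mult)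
qed

text \<open>Numbering the cells by \<open>int_decode\<close> turns countable additivity into an
  ordinary series, whose partial sums run over finite sets of integers.\<close>

lemma emeasure_le_if_sum_floor_cells_le:
  fixes E :: "real set"
  assumes E: "E \<in> sets lebesgue"
    and L: "\<And>I. finite I \<Longrightarrow> (\<Sum>k\<in>I. emeasure lebesgue (E \<inter> {x. \<lfloor>x * R\<rfloor> = k})) \<le> L"
  shows "emeasure lebesgue E \<le> (L :: ennreal)"
proof -
  let ?A = "\<lambda>n. E \<inter> {x. \<lfloor>x * R\<rfloor> = int_decode n}"
  have A: "?A n \<in> sets lebesgue" for n
    by (intro sets.Int E floor_cell_sets_lebesgue)
  have disj: "disjoint_family ?A"
    by (auto simp: disjoint_family_on_def int_decode_eq)
  have "E = (\<Union>n. ?A n)"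
  proof (intro equalityI subsetI)
    fix x assume "x \<in> E"
    then have "x \<in> ?A (int_encode \<lfloor>x * R\<rfloor>)"
      by simp
    then show "x \<in> (\<Union>n. ?A n)"
      by blast
  qed auto
  then have "emeasure lebesgue E = (\<Sum>n. emeasure lebesgue (?A n))"
    using suminf_emeasure[of ?A lebesgue, OF _ disj] A by (metis image_subsetI)
  also have "\<dots> \<le> L"
  proof (rule suminf_le_const)
    fix n
    have "(\<Sum>i<n. emeasure lebesgue (?A i))
        = (\<Sum>k\<in>int_decode ` {..<n}. emeasure lebesgue (E \<inter> {x. \<lfloor>x * R\<rfloor> = k}))"
      by (subst sum.reindex) (auto simp: inj_on_def int_decode_eq)
    also have "\<dots> \<le> L"
      by (rule L) simp
    finally show "(\<Sum>i<n. emeasure lebesgue (?A i)) \<le> L" .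
  qed simp
  finally show ?thesis .
qed

text \<open>Otherwise \<open>E\<close> would be a countable union of null sets. The radii
  \<open>Suc n\<close> are at least 1, so that \<open>R\<close> can later serve as a
  divisor.\<close>

lemma ex_bounded_part_positive_measure:
  assumes E: "E \<in> sets lebesgue" and pos: "0 < emeasure lebesgue (E :: real set)"
  obtains R :: real where "1 \<le> R" "0 < measure lebesgue (E \<inter> {-R..R})"
proof (rule ccontr)
  assume "\<not> thesis"
  then have "measure lebesgue (E \<inter> {- real (Suc n)..real (Suc n)}) \<le> 0" for n
    using that[of "real (Suc n)"] by (intro leI notI) simp_all
  moreover have "E \<inter> {- real (Suc n)..real (Suc n)} \<in> lmeasurable" for n
    using fmeasurable_Int_fmeasurable[of "{- real (Suc n)..real (Suc n)}" lebesgue E] E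
    by (simp add: Int_commute)
  ultimately have "E \<inter> {- real (Suc n)..real (Suc n)} \<in> null_sets lebesgue" for n
    by (metis fmeasurableD emeasure_eq_measure2 ennreal_0 measure_nonneg null_setsI order_antisym)
  then have "(\<Union>n. E \<inter> {- real (Suc n)..real (Suc n)}) \<in> null_sets lebesgue"
    by (rule null_sets_UN)
  moreover have "E = (\<Union>n. E \<inter> {- real (Suc n)..real (Suc n)})"
  proof (intro equalityI subsetI)
    fix x assume "x \<in> E"
    moreover obtain n where "\<bar>x\<bar> \<le> real n"
      using real_arch_simple by blast
    ultimately have "x \<in> E \<inter> {- real (Suc n)..real (Suc n)}"
      by auto
    then show "x \<in> (\<Union>n. E \<inter> {- real (Suc n)..real (Suc n)})"
      by blast
  qed auto
  ultimately show False
    using pos by auto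
qed

lemma hilbert_schmidt_imp_finite_measure:
  assumes E: "E \<in> sets lebesgue" and pos: "0 < emeasure lebesgue E"
    and hs: "hilbert_schmidt_L2 (lebesgue_on E) (truncated_fourier E)"
  shows "emeasure lebesgue E < \<infinity>"
proof (rule ccontr)
  assume inf: "\<not> emeasure lebesgue E < \<infinity>"
  let ?M = "lebesgue_on E" and ?T = "truncated_fourier E"
  have T: "bounded_operator_L2 ?M ?T"
    using hs by (simp add: hilbert_schmidt_L2_def)
  obtain B where B: "orthonormal_basis_L2 ?M B" and sum: "(\<lambda>f. (L2_norm ?M (?T f))\<^sup>2) summable_on B"
    using hs by (auto simp: hilbert_schmidt_L2_def)
  define S where "S = (\<Sum>\<^sub>\<infinity>f\<in>B. (L2_norm ?M (?T f))\<^sup>2)"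
  obtain R where R: "1 \<le> R" and D_pos: "0 < measure lebesgue (E \<inter> {-R..R})"
    using ex_bounded_part_positive_measure[OF E pos] .
  define D where "D = E \<inter> {-R..R}"
  have D: "D \<in> lmeasurable"
    using fmeasurable_Int_fmeasurable[of "{-R..R}" lebesgue E] E
    by (simp add: D_def Int_commute)
  \<comment> \<open>The cell length \<open>1 / R\<close> matches the bound \<open>R\<close> on the
    modulus of the points \<open>t\<close> of \<open>D\<close>: the product of \<open>t\<close> with
    the distance to the left end point of a cell is at most 1 in modulus.\<close>
  define A where "A k = E \<inter> {x. \<lfloor>x * R\<rfloor> = k}" for k
  have A_bounds: "real_of_int k / R \<le> x" "x \<le> real_of_int (k + 1) / R" if "x \<in> A k" for k x
  proof -
    have "real_of_int k \<le> x * R" "x * R \<le> real_of_int (k + 1)"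
      using that by (auto simp: A_def)
    then show "real_of_int k / R \<le> x" "x \<le> real_of_int (k + 1) / R"
      using R by (simp_all add: field_simps)
  qed
  have A: "A k \<in> lmeasurable" for k
  proof (rule fmeasurableI2)
    show "{real_of_int k / R..real_of_int (k + 1) / R} \<in> lmeasurable"
      by simp
    show "A k \<subseteq> {real_of_int k / R..real_of_int (k + 1) / R}"
      using A_bounds by auto
    show "A k \<in> sets lebesgue"
      unfolding A_def by (intro sets.Int E floor_cell_sets_lebesgue)
  qed
  define \<mu> where "\<mu> k = measure lebesgue (A k)" for k
  \<comment> \<open>For a null cell the factor \<open>1 / sqrt (\<mu> k)\<close> is 0 and
    \<open>g k\<close> is the zero function; such cells are kept out of the orthonormal system by
    \<open>0 < \<mu> k\<close>.\<close>
  define g where "g k \<xi> = complex_of_real (1 / sqrt (\<mu> k)) * indicator (A k) \<xi>" for k \<xi>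
  have ind: "integrable lebesgue (indicator (A k) :: real \<Rightarrow> complex)"
    "integrable lebesgue (indicator (A k) :: real \<Rightarrow> real)" for k
    using A[of k] by (auto intro: integrable_indicator_complex simp: fmeasurable_def)
  have g1: "integrable lebesgue (g k)" for k
    unfolding g_def using ind by simp
  have g_sq: "(cmod (g k \<xi>))\<^sup>2 = (1 / sqrt (\<mu> k))\<^sup>2 * indicator (A k) \<xi>" for k \<xi>
    by (simp add: g_def norm_mult norm_divide power_divide split: split_indicator)
  have g2: "g k \<in> L2 lebesgue" for k
    using g1[of k] ind[of k] by (simp add: L2_def g_sq)
  have gM: "g k \<in> L2 ?M" for k
    by (rule L2_restrict_space[OF E g2])
  have g_out: "g k \<xi> = 0" if "\<xi> \<notin> E" for k \<xi>
    using that by (simp add: g_def A_def)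
  have "L2_inner ?M (g j) (g k) = (if j = k then 1 else 0)" if "0 < \<mu> j" for j k
  proof -
    have "indicator E \<xi> *\<^sub>R (g j \<xi> * cnj (g k \<xi>))
        = (if j = k then complex_of_real (1 / \<mu> k * indicator (A k) \<xi>) else 0)" for \<xi>
      using that by (auto simp: g_def A_def indicator_def simp flip: of_real_mult)
    then have "L2_inner ?M (g j) (g k)
        = (LINT \<xi>|lebesgue. (if j = k then complex_of_real (1 / \<mu> k * indicator (A k) \<xi>) else 0))"
      using E by (simp add: L2_inner_def integral_restrict_space)
    also have "\<dots> = (if j = k then complex_of_real (LINT \<xi>|lebesgue. 1 / \<mu> k * indicator (A k) \<xi>) else 0)"
      by (simp only: integral_complex_of_real integral_zero split: if_split) simp
    also have "(LINT \<xi>|lebesgue. 1 / \<mu> k * indicator (A k) \<xi>) = 1 / \<mu> k * \<mu> k"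
      by (simp add: \<mu>_def)
    finally show ?thesis
      using that by (auto split: if_splits)
  qed
  then have orth: "orthonormal_L2 ?M g I" if "I \<subseteq> {k. 0 < \<mu> k}" for I
    using that gM by (auto simp: orthonormal_L2_def)
  \<comment> \<open>Integrating the pointwise bound \<open>\<mu> k / (8 * pi)\<close> over
    \<open>D\<close> produces this factor of \<open>\<mu> k\<close>; here \<open>8 * pi\<close> is
    the square of \<open>2 * sqrt (2 * pi)\<close>.\<close>
  define c where "c = measure lebesgue D / (8 * pi)"
  have c: "0 < c"
    using D_pos by (simp add: c_def D_def)
  have lower: "c * \<mu> k \<le> (L2_norm ?M (?T (g k)))\<^sup>2" if k: "0 < \<mu> k" for k
  proof -
    let ?F = "fourier_integral UNIV (g k)"
    \<comment> \<open>Extension by zero leaves \<open>g k\<close> unchanged, and since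
      \<open>E\<close> has infinite measure \<open>?T\<close> acts on it as the Fourier-Plancherel
      transform.\<close>
    have "(\<lambda>\<xi>. if \<xi> \<in> E then g k \<xi> else 0) = g k"
      using g_out by auto
    then have "?T (g k) = fourier_plancherel (g k)"
      using inf by (simp add: truncated_fourier_def)
    then have "AE t in lebesgue. ?T (g k) t = ?F t"
      using fourier_plancherel_eq_fourier_integral[OF g1 g2] by simp
    then have ae: "AE t in ?M. ?T (g k) t = ?F t"
      using E by (auto simp: AE_restrict_space_iff elim: eventually_mono)
    have F2: "?F \<in> L2 lebesgue"
      by (rule Plancherel_le(1)[OF g1 g2])
    then have FM: "?F \<in> L2 ?M"
      by (rule L2_restrict_space[OF E])
    have F_lower: "\<mu> k / (8 * pi) \<le> (cmod (?F t))\<^sup>2" if t: "t \<in> D" for t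
    proof -
      have "\<bar>t * (\<xi> - real_of_int k / R)\<bar> \<le> 1" if "\<xi> \<in> A k" for \<xi>
      proof -
        have "\<bar>\<xi> - real_of_int k / R\<bar> \<le> 1 / R"
          using A_bounds[OF that] by (simp add: add_divide_distrib)
        moreover have "\<bar>t\<bar> \<le> R"
          using t by (auto simp: D_def)
        ultimately have "\<bar>t\<bar> * \<bar>\<xi> - real_of_int k / R\<bar> \<le> R * (1 / R)"
          using R by (intro mult_mono) auto
        then show ?thesis
          using R by (simp add: abs_mult)
      qed
      then have "\<mu> k / (2 * sqrt (2 * pi)) \<le> cmod (fourier_integral UNIV (indicator (A k)) t)"
        unfolding \<mu>_def by (intro fourier_integral_indicator_ge A)
      then have "1 / sqrt (\<mu> k) * (\<mu> k / (2 * sqrt (2 * pi)))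
          \<le> 1 / sqrt (\<mu> k) * cmod (fourier_integral UNIV (indicator (A k)) t)"
        using k by (intro mult_left_mono) auto
      also have "\<dots> = cmod (?F t)"
        using k unfolding g_def fourier_integral_cmult by (simp add: norm_mult norm_divide)
      finally have "(1 / sqrt (\<mu> k) * (\<mu> k / (2 * sqrt (2 * pi))))\<^sup>2 \<le> (cmod (?F t))\<^sup>2"
        using k by (intro power_mono) auto
      then show ?thesis
        using k by (simp add: power_mult_distrib power_divide power2_eq_square[of "\<mu> k"])
    qed
    have "c * \<mu> k = (LINT t|lebesgue. \<mu> k / (8 * pi) * indicator D t)"
      by (simp add: c_def)
    also have "\<dots> \<le> (LINT t|lebesgue. indicator E t *\<^sub>R (cmod (?F t))\<^sup>2)"
    proof (rule integral_mono)
      show "integrable lebesgue (\<lambda>t. \<mu> k / (8 * pi) * indicator D t)"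
        using D by (auto simp: fmeasurable_def)
      show "integrable lebesgue (\<lambda>t. indicator E t *\<^sub>R (cmod (?F t))\<^sup>2)"
        using F2 E by (intro integrable_mult_indicator) (auto simp: L2_def)
      show "\<mu> k / (8 * pi) * indicator D t \<le> indicator E t *\<^sub>R (cmod (?F t))\<^sup>2" for t
        using F_lower[of t] by (auto simp: D_def indicator_def)
    qed
    also have "\<dots> = (L2_norm ?M ?F)\<^sup>2"
      using E by (simp add: L2_norm_power2 integral_restrict_space)
    also have "\<dots> = (L2_norm ?M (?T (g k)))\<^sup>2"
      using L2_norm_cong_AE[OF bounded_operator_L2D(1)[OF T gM] FM ae] by simp
    finally show ?thesis .
  qed
  have "emeasure lebesgue E \<le> ennreal (S / c)"
  proof (rule emeasure_le_if_sum_floor_cells_le[OF E])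
    fix I :: "int set" assume I: "finite I"
    \<comment> \<open>Null cells contribute nothing to the sum of measures, so only those cells are
      kept for which \<open>g k\<close> is normalised.\<close>
    define J where "J = {k \<in> I. 0 < \<mu> k}"
    have "c * (\<Sum>k\<in>J. \<mu> k) \<le> (\<Sum>k\<in>J. (L2_norm ?M (?T (g k)))\<^sup>2)"
      unfolding sum_distrib_left by (intro sum_mono lower) (simp add: J_def)
    also have "\<dots> \<le> S"
      unfolding S_def using I by (intro sum_orthonormal_L2_le_infsum T B sum orth) (auto simp: J_def)
    finally have "(\<Sum>k\<in>J. \<mu> k) \<le> S / c"
      using c by (simp add: pos_le_divide_eq mult.commute)
    moreover have "(\<Sum>k\<in>J. \<mu> k) = (\<Sum>k\<in>I. \<mu> k)"
      using I by (intro sum.mono_neutral_left) (auto simp: J_def \<mu>_def not_less measure_le_0_iff)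
    ultimately have "(\<Sum>k\<in>I. ennreal (\<mu> k)) \<le> ennreal (S / c)"
      by (simp add: sum_ennreal \<mu>_def ennreal_leI)
    then show "(\<Sum>k\<in>I. emeasure lebesgue (E \<inter> {x. \<lfloor>x * R\<rfloor> = k})) \<le> ennreal (S / c)"
      using A by (simp add: \<mu>_def emeasure_eq_measure2 flip: A_def)
  qed
  with inf show False
    by (auto simp: less_top[symmetric] top_unique)
qed

theorem theorem1p6:
  fixes E :: "real set"
  assumes "E \<in> sets lebesgue"
    and "0 < emeasure lebesgue E"
    and "hilbert_schmidt_L2 (lebesgue_on E) (truncated_fourier E)"
  shows "emeasure lebesgue E < \<infinity> \<and>
    hilbert_schmidt_norm_L2 (lebesgue_on E) (truncated_fourier E) = measure lebesgue E / sqrt (2 * pi)"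
proof
  show fin: "emeasure lebesgue E < \<infinity>"
    by (rule hilbert_schmidt_imp_finite_measure[OF assms])
  \<comment> \<open>The Hilbert-Schmidt hypothesis supplies a basis, so the \<open>SOME\<close> in
    the definition of the norm really denotes one.\<close>
  have "\<exists>B. orthonormal_basis_L2 (lebesgue_on E) B"
    using assms(3) by (auto simp: hilbert_schmidt_L2_def)
  then have "orthonormal_basis_L2 (lebesgue_on E) (SOME B. orthonormal_basis_L2 (lebesgue_on E) B)"
    by (rule someI_ex)
  from orthonormal_basis_fourier_integral_has_sum[OF assms(1) fin this]
  have "hilbert_schmidt_norm_L2 (lebesgue_on E) (truncated_fourier E) = sqrt ((measure lebesgue E)\<^sup>2 / (2 * pi))"
    using fin by (simp add: hilbert_schmidt_norm_L2_def truncated_fourier_def infsumI)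
  then show "hilbert_schmidt_norm_L2 (lebesgue_on E) (truncated_fourier E) = measure lebesgue E / sqrt (2 * pi)"
    by (simp add: real_sqrt_divide)
qed

end
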